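(* Let $k\ge1$ be an integer, $f\in C_c^k(\mathbb{R}^n)$, $\gamma\in\mathbb{R}\setminus\{0\}$, and $0<q<\infty$. For $x\in\mathbb{R}^n$ and $\lambda>0$ set $$E_{x,k}(f,\lambda,q,\gamma):=\left\{h\in\mathbb{R}^n:|\Delta_h^kf(x)|>\lambda|h|^{k+\gamma/q}\right\}.$$ Then, for every $x\in\mathbb{R}^n$, $$\lim_{\lambda\to\infty}\lambda\left(\int_{E_{x,k}(f,\lambda,q,\gamma)}|h|^{\gamma-n}\,dh\right)^{1/q}=\gamma^{-1/q}\mathcal A_{n,k,q}(D^kf(x))\quad\text{if }\gamma>0,$$ $$\lim_{\lambda\to0^+}\lambda\left(\int_{E_{x,k}(f,\lambda,q,\gamma)}|h|^{\gamma-n}\,dh\right)^{1/q}=(-\gamma)^{-1/q}\mathcal A_{n,k,q}(D^kf(x))\quad\text{if }\gamma<0.$$ Moreover, there is a constant $C_k$ depending only on $k$ such that $$\sup_{\lambda>0}\lambda\left(\int_{E_{x,k}(f,\lambda,q,\gamma)}|h|^{\gamma-n}\,dh\right)^{1/q}\le C_k|\gamma|^{-1/q}\left(\int_{\mathbb S^{n-1}}M_\theta(|D_\theta^kf|)(x)^q\,d\theta\right)^{1/q}.$$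
   Context: For $h\in\mathbb{R}^n$, $\Delta_h^kf(x):=\sum_{j=0}^k(-1)^{k-j}\binom kj f(x+jh)$. $D^kf(x)$ is the symmetric $k$-linear form $D^kf(x)[v_1,\dots,v_k]=\sum_{i_1,\dots,i_k=1}^n\partial_{i_1}\cdots\partial_{i_k}f(x)(v_1)_{i_1}\cdots(v_k)_{i_k}$. For a symmetric $k$-linear form $A$ on $\mathbb{R}^n$, $A[v^k]:=A[v,\dots,v]$ and $\mathcal A_{n,k,q}(A):=\left(\int_{\mathbb S^{n-1}}|A[\theta^k]|^q\,d\theta\right)^{1/q}$. $D_\theta^kf(x):=D^kf(x)[\theta^k]$. For $\theta\in\mathbb S^{n-1}$, $M_\theta g(x):=\sup_{t>0}\frac1t\int_0^t|g(x+r\theta)|\,dr$. *)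

theory Defs
  imports "HOL-Analysis.Analysis"
begin

text \<open>
  The constant in the theorem must not depend on the dimension \<open>n\<close>, so \<open>n\<close> has to be quantified
  inside the formula and cannot be a type. Points of \<open>n\<close>-space are therefore functions on
  \<open>{..<n}\<close>, extended by \<open>undefined\<close>; this is the space of the product measure \<^const>\<open>PiM\<close>.
  Only the values of \<open>f\<close> on \<open>Rn n\<close> matter. Topological notions refer to the
  product topology on \<^typ>\<open>nat \<Rightarrow> real\<close>, in which \<open>Rn n\<close> is a closed copy of Euclidean \<open>n\<close>-space.
\<close>

type_synonym vec = "nat \<Rightarrow> real"

definition Rn :: "nat \<Rightarrow> vec set" where
  "Rn n = {..<n} \<rightarrow>\<^sub>E UNIV"

abbreviation lebesgue_Rn :: "nat \<Rightarrow> vec measure" where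
  "lebesgue_Rn n \<equiv> PiM {..<n} (\<lambda>_. lborel)"

definition vnorm :: "nat \<Rightarrow> vec \<Rightarrow> real" where
  "vnorm n x = L2_set x {..<n}"

definition scale :: "nat \<Rightarrow> real \<Rightarrow> vec \<Rightarrow> vec" where
  "scale n c x = (\<lambda>i\<in>{..<n}. c * x i)"

definition add_scaled :: "nat \<Rightarrow> vec \<Rightarrow> real \<Rightarrow> vec \<Rightarrow> vec" where
  "add_scaled n x c h = (\<lambda>i\<in>{..<n}. x i + c * h i)"

text \<open>
  Surface measure on the unit sphere of \<open>n\<close>-space (\<open>n \<ge> 1\<close>), normalised so that integration in
  polar coordinates reads \<open>dx = r\<^sup>n\<^sup>-\<^sup>1 dr d\<theta>\<close>: a set \<open>A\<close> of directions has measure \<open>n\<close> times the volume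
  of the cone of all \<open>r \<theta>\<close> with \<open>0 < r \<le> 1\<close> and \<open>\<theta>\<close> in \<open>A\<close>. For \<open>n = 1\<close> this is counting measure
  on the two unit vectors. It is a measure on all of \<open>Rn n\<close> that is concentrated on the sphere.
\<close>

definition sphere_measure :: "nat \<Rightarrow> vec measure" where
  "sphere_measure n =
     distr (density (lebesgue_Rn n)
              (\<lambda>h. of_nat n * indicator {h. 0 < vnorm n h \<and> vnorm n h \<le> 1} h))
       (lebesgue_Rn n) (\<lambda>h. scale n (1 / vnorm n h) h)"

text \<open>The power \<open>a\<^sup>p\<close> of an extended nonnegative real, for exponents \<open>p > 0\<close>.\<close>

definition epowr :: "ennreal \<Rightarrow> real \<Rightarrow> ennreal" where
  "epowr a p = (if a = \<infinity> then \<infinity> else ennreal (enn2real a powr p))"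

definition partial :: "nat \<Rightarrow> (vec \<Rightarrow> real) \<Rightarrow> vec \<Rightarrow> real" where
  "partial i f x = deriv (\<lambda>t. f (x(i := t))) (x i)"

text \<open>\<open>partials [i\<^sub>1, \<dots>, i\<^sub>k] f\<close> is \<open>\<partial>\<^sub>i\<^sub>1 \<cdots> \<partial>\<^sub>i\<^sub>k f\<close>, with \<open>\<partial>\<^sub>i\<^sub>k\<close> applied first.\<close>

fun partials :: "nat list \<Rightarrow> (vec \<Rightarrow> real) \<Rightarrow> vec \<Rightarrow> real" where
  "partials [] f = f"
| "partials (i # is) f = partial i (partials is f)"

definition Ck :: "nat \<Rightarrow> nat \<Rightarrow> (vec \<Rightarrow> real) \<Rightarrow> bool" where
  "Ck n k f \<longleftrightarrow>
     (\<forall>is. set is \<subseteq> {..<n} \<and> length is < k \<longrightarrow>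
        (\<forall>i<n. \<forall>x\<in>Rn n. (\<lambda>t. partials is f (x(i := t))) differentiable (at (x i)))) \<and>
     (\<forall>is. set is \<subseteq> {..<n} \<and> length is \<le> k \<longrightarrow> continuous_on (Rn n) (partials is f))"

definition Ck_compact :: "nat \<Rightarrow> nat \<Rightarrow> (vec \<Rightarrow> real) \<Rightarrow> bool" where
  "Ck_compact n k f \<longleftrightarrow> Ck n k f \<and> compact (closure {x \<in> Rn n. f x \<noteq> 0})"

text \<open>Forms take the list \<open>[v\<^sub>1, \<dots>, v\<^sub>k]\<close> of their arguments.\<close>

definition Dform :: "nat \<Rightarrow> nat \<Rightarrow> (vec \<Rightarrow> real) \<Rightarrow> vec \<Rightarrow> vec list \<Rightarrow> real" where
  "Dform n k f x vs =
     (\<Sum>is\<in>{is. length is = k \<and> set is \<subseteq> {..<n}}. partials is f x * (\<Prod>j<k. (vs ! j) (is ! j)))"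

definition Ddir :: "nat \<Rightarrow> nat \<Rightarrow> vec \<Rightarrow> (vec \<Rightarrow> real) \<Rightarrow> vec \<Rightarrow> real" where
  "Ddir n k \<theta> f x = Dform n k f x (replicate k \<theta>)"

definition Anorm :: "nat \<Rightarrow> nat \<Rightarrow> real \<Rightarrow> (vec list \<Rightarrow> real) \<Rightarrow> ennreal" where
  "Anorm n k q A =
     epowr (\<integral>\<^sup>+\<theta>. ennreal (\<bar>A (replicate k \<theta>)\<bar> powr q) \<partial>sphere_measure n) (1 / q)"

definition fdiff :: "nat \<Rightarrow> nat \<Rightarrow> vec \<Rightarrow> (vec \<Rightarrow> real) \<Rightarrow> vec \<Rightarrow> real" where
  "fdiff n k h f x =
     (\<Sum>j\<le>k. (-1) ^ (k - j) * real (k choose j) * f (add_scaled n x (real j) h))"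

definition Mdir :: "nat \<Rightarrow> vec \<Rightarrow> (vec \<Rightarrow> real) \<Rightarrow> vec \<Rightarrow> ennreal" where
  "Mdir n \<theta> g x =
     (SUP t\<in>{0<..}. ennreal (1 / t) * (\<integral>\<^sup>+r\<in>{0..t}. ennreal \<bar>g (add_scaled n x r \<theta>)\<bar> \<partial>lborel))"

text \<open>
  The origin is never in \<open>E_set\<close>: for \<open>k \<ge> 1\<close> the difference vanishes at \<open>h = 0\<close>. So the value that
  \<^const>\<open>powr\<close> assigns to \<open>0\<close> with a negative exponent is irrelevant here.
\<close>

definition E_set :: "nat \<Rightarrow> nat \<Rightarrow> (vec \<Rightarrow> real) \<Rightarrow> real \<Rightarrow> real \<Rightarrow> real \<Rightarrow> vec \<Rightarrow> vec set" where
  "E_set n k f lam q \<gamma> x =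
     {h \<in> Rn n. \<bar>fdiff n k h f x\<bar> > lam * vnorm n h powr (real k + \<gamma> / q)}"

definition weak_functional ::
  "nat \<Rightarrow> nat \<Rightarrow> (vec \<Rightarrow> real) \<Rightarrow> real \<Rightarrow> real \<Rightarrow> real \<Rightarrow> vec \<Rightarrow> ennreal" where
  "weak_functional n k f lam q \<gamma> x =
     ennreal lam *
     epowr (\<integral>\<^sup>+h\<in>E_set n k f lam q \<gamma> x. ennreal (vnorm n h powr (\<gamma> - real n)) \<partial>lebesgue_Rn n) (1 / q)"

end

theory Submission
  imports Defs
begin

text \<open>
  In polar coordinates the functional becomes an integral over directions \<open>\<theta>\<close> of one-dimensional
  integrals of \<open>r\<^sup>\<gamma>\<^sup>-\<^sup>1\<close> over all \<open>r > 0\<close> with \<open>D r > \<lambda> r\<^bsup>\<gamma>/q\<^esup>\<close>, where \<open>D r\<close> is the absolute difference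
  of order \<open>k\<close> in direction \<open>r \<theta>\<close>, divided by \<open>r\<^sup>k\<close>. For a constant \<open>D = a\<close> this integral is
  \<open>(a / \<lambda>)\<^sup>q / \<bar>\<gamma>\<bar>\<close>. By \<open>k - 1\<close> mean value steps the difference equals \<open>r\<^sup>k\<^sup>-\<^sup>1\<close> times an increment of
  the directional derivative of order \<open>k - 1\<close> over an interval of length \<open>r\<close>. Hence \<open>D\<close> is at most \<open>k\<close>
  times the directional maximal function, which gives the uniform estimate with constant \<open>k\<close>; and \<open>D\<close> is
  bounded and tends to the directional derivative at \<open>x\<close> as \<open>r\<close> tends to 0. The limits
  follow by dominated convergence after the substitution \<open>r = \<epsilon> s\<close>, \<open>\<lambda> = \<epsilon>\<^bsup>-\<gamma>/q\<^esup>\<close>, which turns both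
  regimes of \<open>\<lambda>\<close> into \<open>\<epsilon> \<rightarrow> 0\<close>.
\<close>

subsection \<open>Iterated differences on the line\<close>

definition line_diff :: "nat \<Rightarrow> real \<Rightarrow> (real \<Rightarrow> real) \<Rightarrow> real \<Rightarrow> real" where
  "line_diff k r g t = (\<Sum>j\<le>k. (-1) ^ (k - j) * real (k choose j) * g (t + real j * r))"

text \<open>Pascal's rule splits each coefficient \<open>Suc k choose Suc j\<close>. The part with
  \<open>k choose j\<close> is the difference based at \<open>t + r\<close>; the part with
  \<open>k choose Suc j\<close>, completed by the term at index 0, is minus the difference based at
  \<open>t\<close>.\<close>

lemma line_diff_Suc: "line_diff (Suc k) r g t = line_diff k r g (t + r) - line_diff k r g t"
proof -
  let ?g = "\<lambda>j. g (t + real j * r)"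
  have "line_diff (Suc k) r g t = (-1) ^ Suc k * ?g 0 +
      (\<Sum>j\<le>k. (-1) ^ (k - j) * real (Suc k choose Suc j) * ?g (Suc j))"
    unfolding line_diff_def by (subst sum.atMost_Suc_shift) simp
  also have "(\<Sum>j\<le>k. (-1) ^ (k - j) * real (Suc k choose Suc j) * ?g (Suc j)) =
      (\<Sum>j\<le>k. (-1) ^ (k - j) * real (k choose j) * ?g (Suc j)) +
      (\<Sum>j\<le>k. (-1) ^ (k - j) * real (k choose Suc j) * ?g (Suc j))"
    by (simp add: sum.distrib [symmetric] algebra_simps)
  also have "(\<Sum>j\<le>k. (-1) ^ (k - j) * real (k choose j) * ?g (Suc j)) = line_diff k r g (t + r)"
    unfolding line_diff_def by (simp add: algebra_simps)
  \<comment> \<open>The sign is written through \<open>Suc k - Suc j\<close> so that this becomes a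
    shifted sum, which the separate term at index 0 completes.\<close>
  also have "(\<Sum>j\<le>k. (-1) ^ (k - j) * real (k choose Suc j) * ?g (Suc j)) =
      (\<Sum>j\<le>k. - ((-1) ^ (Suc k - Suc j) * (-1) * real (k choose Suc j) * ?g (Suc j)))"
    by (intro sum.cong) auto
  also have "\<dots> = - (\<Sum>j\<le>k. (-1) ^ (Suc k - Suc j) * (-1) * real (k choose Suc j) * ?g (Suc j))"
    by (simp add: sum_negf)
  also have "(-1) ^ Suc k * ?g 0 + (line_diff k r g (t + r) + \<dots>) =
      line_diff k r g (t + r) -
      (\<Sum>j\<le>Suc k. (-1) ^ (Suc k - j) * (-1) * real (k choose j) * ?g j)"
    by (subst sum.atMost_Suc_shift) simp
  \<comment> \<open>The top term vanishes because \<open>k choose Suc k\<close> is 0.\<close>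
  also have "(\<Sum>j\<le>Suc k. (-1) ^ (Suc k - j) * (-1) * real (k choose j) * ?g j) =
      (\<Sum>j\<le>k. (-1) ^ (Suc k - j) * (-1) * real (k choose j) * ?g j)"
    by simp
  also have "\<dots> = line_diff k r g t"
    unfolding line_diff_def by (intro sum.cong) (auto simp: Suc_diff_le)
  finally show ?thesis .
qed

lemma line_diff_0 [simp]: "line_diff 0 r g t = g t"
  by (simp add: line_diff_def)

lemma has_real_derivative_line_diff:
  assumes "\<And>t. (g has_real_derivative g' t) (at t)"
  shows "(line_diff k r g has_real_derivative line_diff k r g' t) (at t)"
proof -
  have shift: "((\<lambda>t. g (t + c)) has_real_derivative g' (t + c)) (at t)" for c
    using assms[of "t + c"] by (subst (asm) DERIV_shift) simp
  show ?thesis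
    unfolding line_diff_def [abs_def] by (intro DERIV_sum DERIV_cmult shift)
qed

text \<open>Differencing commutes with differentiation, so each mean value step trades one
  difference for a factor \<open>r\<close> and one derivative, and moves the base point by less than
  \<open>r\<close>. The steps stop at an increment of \<open>G k\<close>, one derivative short of
  the order of the difference, so that this increment can still be written as an integral.\<close>

lemma line_diff_mvt:
  fixes G :: "nat \<Rightarrow> real \<Rightarrow> real"
  assumes "r > 0" "\<And>j t. j < k \<Longrightarrow> (G j has_real_derivative G (Suc j) t) (at t)"
  shows "\<exists>\<xi>. t \<le> \<xi> \<and> \<xi> \<le> t + real k * r \<and>
    line_diff (Suc k) r (G 0) t = r ^ k * (G k (\<xi> + r) - G k \<xi>)"
  using assms(2)
proof (induction k arbitrary: G t)
  case 0
  show ?case by (intro exI[of _ t]) (simp add: line_diff_Suc)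
next
  case (Suc k)
  have "\<exists>z. t < z \<and> z < t + r \<and> line_diff (Suc k) r (G 0) (t + r) - line_diff (Suc k) r (G 0) t
      = (t + r - t) * line_diff (Suc k) r (G 1) z"
    using assms(1) Suc.prems[of 0] by (intro MVT2 has_real_derivative_line_diff) auto
  then obtain z where z: "t < z" "z < t + r"
    "line_diff (Suc (Suc k)) r (G 0) t = r * line_diff (Suc k) r (G 1) z"
    by (auto simp: line_diff_Suc[of "Suc k"])
  from Suc.IH[of "\<lambda>j. G (Suc j)" z] Suc.prems obtain \<xi>
    where "z \<le> \<xi>" "\<xi> \<le> z + real k * r"
      "line_diff (Suc k) r (G 1) z = r ^ k * (G (Suc k) (\<xi> + r) - G (Suc k) \<xi>)"
    by auto
  with z show ?case
    by (intro exI[of _ \<xi>]) (simp add: distrib_right)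
qed

text \<open>One last mean value step uses up the remaining increment. This pointwise form serves the
  bound and the limit of the quotients.\<close>

lemma line_diff_eq_deriv:
  fixes G :: "nat \<Rightarrow> real \<Rightarrow> real"
  assumes "r > 0" "k \<ge> 1" "\<And>j t. j < k \<Longrightarrow> (G j has_real_derivative G (Suc j) t) (at t)"
  shows "\<exists>\<xi>. t \<le> \<xi> \<and> \<xi> \<le> t + real k * r \<and> line_diff k r (G 0) t = r ^ k * G k \<xi>"
proof -
  obtain m where m: "k = Suc m" using assms(2) by (cases k) auto
  obtain \<xi> where \<xi>: "t \<le> \<xi>" "\<xi> \<le> t + real m * r"
    "line_diff (Suc m) r (G 0) t = r ^ m * (G m (\<xi> + r) - G m \<xi>)"
    using line_diff_mvt[of r m G t] assms m by auto
  obtain z where "\<xi> < z" "z < \<xi> + r" "G m (\<xi> + r) - G m \<xi> = (\<xi> + r - \<xi>) * G (Suc m) z"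
    using MVT2[of \<xi> "\<xi> + r" "G m" "G (Suc m)"] assms m by auto
  with \<xi> m show ?thesis by (intro exI[of _ z]) (auto simp: algebra_simps)
qed

text \<open>Here the remaining increment is an integral of \<open>G k\<close> over an interval from
  \<xi> to \<xi> + r. Since \<xi> is at most (k - 1) r, that interval lies in
  \<open>{0..real k * r}\<close>. This integral form serves the maximal function.\<close>

lemma line_diff_le_nn_integral:
  fixes G :: "nat \<Rightarrow> real \<Rightarrow> real"
  assumes "r > 0" "k \<ge> 1" "\<And>j t. j < k \<Longrightarrow> (G j has_real_derivative G (Suc j) t) (at t)"
    and cont: "continuous_on UNIV (G k)"
  shows "ennreal \<bar>line_diff k r (G 0) 0\<bar> \<le>
    ennreal (r ^ (k - 1)) * (\<integral>\<^sup>+s\<in>{0..real k * r}. ennreal \<bar>G k s\<bar> \<partial>lborel)"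
proof -
  obtain m where m: "k = Suc m" using assms(2) by (cases k) auto
  obtain \<xi> where \<xi>: "0 \<le> \<xi>" "\<xi> \<le> 0 + real m * r"
    "line_diff (Suc m) r (G 0) 0 = r ^ m * (G m (\<xi> + r) - G m \<xi>)"
    using line_diff_mvt[of r m G 0] assms m by auto
  have isCont: "isCont (G k) x" for x
    using cont by (simp add: continuous_on_eq_continuous_at)
  have *: "G m (\<xi> + r) - G m \<xi> = (\<integral>x. G k x * indicator {\<xi>..\<xi> + r} x \<partial>lborel)"
    using assms m isCont by (subst integral_FTC_Icc_real[where F = "G m"]) auto
  have "ennreal \<bar>G m (\<xi> + r) - G m \<xi>\<bar> \<le>
      (\<integral>\<^sup>+x. ennreal (norm (G k x * indicator {\<xi>..\<xi> + r} x)) \<partial>lborel)"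
    unfolding * real_norm_def [symmetric]
  proof (rule integral_norm_bound_ennreal)
    have "set_integrable lborel {\<xi>..\<xi> + r} (G k)"
      using borel_integrable_atLeastAtMost'[of \<xi> "\<xi> + r" "G k"] cont continuous_on_subset by blast
    then show "integrable lborel (\<lambda>x. G k x * indicator {\<xi>..\<xi> + r} x)"
      unfolding set_integrable_def by (simp add: mult.commute)
  qed
  also have "\<dots> \<le> (\<integral>\<^sup>+s\<in>{0..real k * r}. ennreal \<bar>G k s\<bar> \<partial>lborel)"
    using \<xi> m by (intro nn_integral_mono) (auto simp: indicator_def algebra_simps)
  finally have "ennreal (r ^ m) * ennreal \<bar>G m (\<xi> + r) - G m \<xi>\<bar> \<le>
      ennreal (r ^ m) * (\<integral>\<^sup>+s\<in>{0..real k * r}. ennreal \<bar>G k s\<bar> \<partial>lborel)"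
    by (rule mult_left_mono) simp
  then show ?thesis
    using \<xi> m assms(1) by (simp add: abs_mult ennreal_mult)
qed

subsection \<open>Polar coordinates\<close>

lemma nn_integral_powr_near_0:
  fixes g c :: real
  assumes "g > 0" "c \<ge> 0"
  shows "(\<integral>\<^sup>+r. indicator {0<..<c} r * ennreal (r powr (g - 1)) \<partial>lborel) = ennreal (c powr g / g)"
proof -
  \<comment> \<open>Strict inequalities in the level sets produce open intervals; the closed
    interval of the integral formula differs by a null set.\<close>
  have "AE r in lborel. r \<noteq> 0 \<and> r \<noteq> c"
    using AE_lborel_singleton[of "0::real"] AE_lborel_singleton[of c] by eventually_elim auto
  then have "(\<integral>\<^sup>+r. indicator {0<..<c} r * ennreal (r powr (g - 1)) \<partial>lborel) =
      (\<integral>\<^sup>+r. ennreal (indicator {0..c} r * r powr (g - 1)) \<partial>lborel)"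
    by (intro nn_integral_cong_AE, elim eventually_mono) (auto simp: indicator_def)
  also have "\<dots> = ennreal (c powr (g - 1 + 1) / (g - 1 + 1))"
    using assms by (intro nn_integral_has_integral_lebesgue has_integral_powr_from_0) auto
  finally show ?thesis by simp
qed

lemma nn_integral_powr_tail:
  fixes g c :: real
  assumes "g < 0" "c > 0"
  shows "(\<integral>\<^sup>+r. indicator {c<..} r * ennreal (r powr (g - 1)) \<partial>lborel) = ennreal (c powr g / (-g))"
proof -
  have "AE r in lborel. r \<noteq> c"
    using AE_lborel_singleton[of c] by eventually_elim auto
  then have "(\<integral>\<^sup>+r. indicator {c<..} r * ennreal (r powr (g - 1)) \<partial>lborel) =
      (\<integral>\<^sup>+r. ennreal (indicator {c..} r * r powr (g - 1)) \<partial>lborel)"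
    by (intro nn_integral_cong_AE, elim eventually_mono) (auto simp: indicator_def)
  also have "\<dots> = ennreal (- (c powr (g - 1 + 1)) / (g - 1 + 1))"
    using assms by (intro nn_integral_has_integral_lebesgue has_integral_powr_to_inf) auto
  finally show ?thesis by simp
qed

section \<open>Lebesgue measure on the product space, the norm and dilations\<close>

lemma space_lebesgue_Rn [simp]: "space (lebesgue_Rn n) = Rn n"
  by (simp add: space_PiM Rn_def)

lemma sigma_finite_lebesgue_Rn: "sigma_finite_measure (lebesgue_Rn n)"
proof -
  interpret product_sigma_finite "\<lambda>_::nat. lborel :: real measure" by standard
  show ?thesis by (rule sigma_finite) simp
qed

lemma pair_sigma_finite_lborel_lebesgue_Rn: "pair_sigma_finite lborel (lebesgue_Rn n)"
  by (simp add: pair_sigma_finite_def sigma_finite_lebesgue_Rn lborel.sigma_finite_measure_axioms)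

lemma measurable_vnorm [measurable]: "vnorm n \<in> borel_measurable (lebesgue_Rn n)"
  unfolding vnorm_def L2_set_def by measurable

lemma measurable_scale [measurable (raw)]:
  assumes [measurable]: "c \<in> borel_measurable M" "h \<in> M \<rightarrow>\<^sub>M lebesgue_Rn n"
  shows "(\<lambda>w. scale n (c w) (h w)) \<in> M \<rightarrow>\<^sub>M lebesgue_Rn n"
proof -
  have [measurable]: "(\<lambda>w. h w i) \<in> borel_measurable M" if "i \<in> {..<n}" for i
    using measurable_compose[OF assms(2) measurable_component_singleton[OF that]] by simp
  show ?thesis
    unfolding scale_def by measurable
qed

lemma scale_in_Rn [simp]: "scale n c h \<in> Rn n"
  by (auto simp: scale_def Rn_def)

lemma scale_scale: "scale n a (scale n b h) = scale n (a * b) h"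
  by (auto simp: scale_def fun_eq_iff)

lemma vnorm_scale: "vnorm n (scale n c h) = \<bar>c\<bar> * vnorm n h"
proof -
  have "(\<Sum>i<n. (c * h i)\<^sup>2) = c\<^sup>2 * (\<Sum>i<n. (h i)\<^sup>2)"
    by (simp add: power_mult_distrib sum_distrib_left)
  then show ?thesis
    by (simp add: vnorm_def L2_set_def scale_def real_sqrt_mult)
qed

lemma vnorm_nonneg [simp]: "vnorm n h \<ge> 0"
  by (simp add: vnorm_def)

lemma abs_coord_le_vnorm: "i < n \<Longrightarrow> \<bar>x i\<bar> \<le> vnorm n x"
  unfolding vnorm_def
  using member_le_L2_set[of "{..<n}" i "\<lambda>i. \<bar>x i\<bar>"] by (simp add: L2_set_def)

text \<open>A product measure is determined by its values on boxes. Pushing forward under the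
  dilation costs a factor 1/c in each of the n coordinates, which \<open>c ^ n\<close>
  restores.\<close>

lemma nn_integral_lebesgue_Rn_scale:
  assumes c: "c > 0" and [measurable]: "\<phi> \<in> borel_measurable (lebesgue_Rn n)"
  shows "(\<integral>\<^sup>+h. \<phi> h \<partial>lebesgue_Rn n) = ennreal (c ^ n) * (\<integral>\<^sup>+h. \<phi> (scale n c h) \<partial>lebesgue_Rn n)"
proof -
  interpret product_sigma_finite "\<lambda>_::nat. lborel :: real measure" by standard
  let ?L = "lebesgue_Rn n"
  have lborel_eq: "ennreal c * emeasure lborel ((\<lambda>t. c * t) -` A) = emeasure lborel A"
    if [measurable]: "A \<in> sets borel" for A :: "real set"
  proof -
    have "emeasure lborel A = (\<integral>\<^sup>+t. indicator A t \<partial>lborel)" by simp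
    also have "\<dots> = ennreal \<bar>c\<bar> * (\<integral>\<^sup>+t. indicator A (0 + c * t) \<partial>lborel)"
      using c by (intro nn_integral_real_affine) auto
    also have "(\<integral>\<^sup>+t. indicator A (0 + c * t) \<partial>lborel) =
        (\<integral>\<^sup>+t. indicator ((\<lambda>t. c * t) -` A) t \<partial>lborel)"
      by (intro nn_integral_cong) (auto simp: indicator_def)
    also have "\<dots> = emeasure lborel ((\<lambda>t. c * t) -` A)"
      by (subst nn_integral_indicator) (auto intro!: measurable_sets_borel[of _ borel])
    finally show ?thesis using c by simp
  qed
  have "scale_measure (ennreal (c ^ n)) (distr ?L ?L (scale n c)) = ?L"
  proof (rule PiM_eqI)
    fix A :: "nat \<Rightarrow> real set" assume A: "\<And>i. i \<in> {..<n} \<Longrightarrow> A i \<in> sets lborel"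
    have A': "(\<lambda>t. c * t) -` A i \<in> sets borel" if "i < n" for i
      using A that by (auto intro!: measurable_sets_borel[of _ borel])
    have "emeasure (distr ?L ?L (scale n c)) (Pi\<^sub>E {..<n} A) =
        emeasure ?L (scale n c -` Pi\<^sub>E {..<n} A \<inter> space ?L)"
      using A by (intro emeasure_distr) (auto intro!: sets_PiM_I_finite)
    also have "scale n c -` Pi\<^sub>E {..<n} A \<inter> space ?L = Pi\<^sub>E {..<n} (\<lambda>i. (\<lambda>t. c * t) -` A i)"
      by (auto simp: scale_def Rn_def PiE_iff)
    also have "emeasure ?L \<dots> = (\<Prod>i<n. emeasure lborel ((\<lambda>t. c * t) -` A i))"
      using A' by (intro emeasure_PiM) auto
    finally show "emeasure (scale_measure (ennreal (c ^ n)) (distr ?L ?L (scale n c))) (Pi\<^sub>E {..<n} A) =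
        (\<Prod>i\<in>{..<n}. emeasure lborel (A i))"
      using A c by (simp add: lborel_eq[symmetric] prod.distrib ennreal_power)
  qed auto
  then have "(\<integral>\<^sup>+h. \<phi> h \<partial>?L) =
      (\<integral>\<^sup>+h. \<phi> h \<partial>scale_measure (ennreal (c ^ n)) (distr ?L ?L (scale n c)))"
    by simp
  also have "\<dots> = ennreal (c ^ n) * (\<integral>\<^sup>+h. \<phi> (scale n c h) \<partial>?L)"
    by (subst nn_integral_scale_measure) (auto simp: nn_integral_distr)
  finally show ?thesis .
qed

section \<open>The sphere measure: support and total mass\<close>

lemma sets_sphere_measure [measurable_cong]: "sets (sphere_measure n) = sets (lebesgue_Rn n)"
  by (simp add: sphere_measure_def)

lemma nn_integral_sphere_measure:
  assumes [measurable]: "\<psi> \<in> borel_measurable (lebesgue_Rn n)"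
  shows "(\<integral>\<^sup>+\<theta>. \<psi> \<theta> \<partial>sphere_measure n) =
    (\<integral>\<^sup>+h. of_nat n * indicator {h. 0 < vnorm n h \<and> vnorm n h \<le> 1} h *
      \<psi> (scale n (1 / vnorm n h) h) \<partial>lebesgue_Rn n)"
proof -
  have [measurable]: "(\<lambda>h. indicator {h. 0 < vnorm n h \<and> vnorm n h \<le> 1} h :: ennreal)
      \<in> borel_measurable (lebesgue_Rn n)"
    by (simp add: indicator_def [abs_def])
  show ?thesis
    unfolding sphere_measure_def by (subst nn_integral_distr; simp add: nn_integral_density)
qed

lemma AE_vnorm_pos:
  assumes "n \<ge> 1"
  shows "AE h in lebesgue_Rn n. vnorm n h > 0"
proof -
  interpret product_sigma_finite "\<lambda>_::nat. lborel :: real measure" by standard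
  have "emeasure (lebesgue_Rn n) (Pi\<^sub>E {..<n} (\<lambda>_. {0})) = (\<Prod>i<n. emeasure lborel {0::real})"
    by (intro emeasure_PiM) auto
  \<comment> \<open>At least one factor 0 is present because n \<ge> 1; an empty product would be
    1.\<close>
  also have "\<dots> = 0" using assms by (simp add: power_0_left)
  finally have z: "emeasure (lebesgue_Rn n) (Pi\<^sub>E {..<n} (\<lambda>_. {0})) = 0" .
  have "Pi\<^sub>E {..<n} (\<lambda>_. {0}) \<in> sets (lebesgue_Rn n)"
    by (rule sets_PiM_I_finite) auto
  with z have "Pi\<^sub>E {..<n} (\<lambda>_. {0}) \<in> null_sets (lebesgue_Rn n)"
    by (rule null_setsI)
  then show ?thesis
  proof (rule AE_I')
    show "{h \<in> space (lebesgue_Rn n). \<not> vnorm n h > 0} \<subseteq> Pi\<^sub>E {..<n} (\<lambda>_. {0})"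
    proof (rule subsetI)
      fix h assume h: "h \<in> {h \<in> space (lebesgue_Rn n). \<not> vnorm n h > 0}"
      then have "vnorm n h = 0" using vnorm_nonneg[of n h] by auto
      then have "h i = 0" if "i < n" for i
        using that by (auto simp: vnorm_def L2_set_eq_0_iff)
      moreover have "h i = undefined" if "i \<notin> {..<n}" for i
        using h that by (intro PiE_arb[of h "{..<n}" "\<lambda>_. UNIV"]) (simp_all add: Rn_def)
      ultimately show "h \<in> Pi\<^sub>E {..<n} (\<lambda>_. {0})"
        by (intro PiE_I) simp_all
    qed
  qed
qed

lemma AE_sphere_measure: "AE \<theta> in sphere_measure n. \<theta> \<in> Rn n \<and> vnorm n \<theta> = 1"
proof -
  have [measurable]: "(\<lambda>h. indicator {h. 0 < vnorm n h \<and> vnorm n h \<le> 1} h :: ennreal)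
      \<in> borel_measurable (lebesgue_Rn n)"
    by (simp add: indicator_def [abs_def])
  have "{\<theta> \<in> space (lebesgue_Rn n). \<theta> \<in> Rn n \<and> vnorm n \<theta> = 1} = {\<theta> \<in> space (lebesgue_Rn n). vnorm n \<theta> = 1}"
    by auto
  also have "\<dots> \<in> sets (lebesgue_Rn n)" by measurable
  finally have m: "{\<theta> \<in> space (lebesgue_Rn n). \<theta> \<in> Rn n \<and> vnorm n \<theta> = 1} \<in> sets (lebesgue_Rn n)" .
  show ?thesis
    unfolding sphere_measure_def
    by (subst AE_distr_iff[OF _ m])
       (auto simp: AE_density vnorm_scale indicator_def split: if_splits)
qed

text \<open>The unit ball lies in a cube of side 2, so the total mass is at most n 2^n. Constants
  are therefore integrable majorants on the sphere.\<close>

lemma emeasure_sphere_measure_finite: "emeasure (sphere_measure n) (space (sphere_measure n)) < \<infinity>"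
proof -
  interpret product_sigma_finite "\<lambda>_::nat. lborel :: real measure" by standard
  have "emeasure (sphere_measure n) (space (sphere_measure n)) = (\<integral>\<^sup>+\<theta>. 1 \<partial>sphere_measure n)"
    by simp
  also have "\<dots> = (\<integral>\<^sup>+h. of_nat n * indicator {h. 0 < vnorm n h \<and> vnorm n h \<le> 1} h \<partial>lebesgue_Rn n)"
    by (subst nn_integral_sphere_measure) auto
  also have "\<dots> \<le> (\<integral>\<^sup>+h. of_nat n * indicator (Pi\<^sub>E {..<n} (\<lambda>_. {-1..1})) h \<partial>lebesgue_Rn n)"
  proof (intro nn_integral_mono mult_left_mono)
    fix h assume h: "h \<in> space (lebesgue_Rn n)"
    have "h \<in> Pi\<^sub>E {..<n} (\<lambda>_. {-1..1})" if "vnorm n h \<le> 1"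
    proof (rule PiE_I)
      show "h i \<in> {-1..1}" if "i \<in> {..<n}" for i
        using abs_coord_le_vnorm[of i n h] \<open>vnorm n h \<le> 1\<close> that by (simp add: abs_le_iff)
      show "h i = undefined" if "i \<notin> {..<n}" for i
        using h that by (intro PiE_arb[of h "{..<n}" "\<lambda>_. UNIV"]) (simp_all add: Rn_def)
    qed
    then show "indicator {h. 0 < vnorm n h \<and> vnorm n h \<le> 1} h
        \<le> (indicator (Pi\<^sub>E {..<n} (\<lambda>_. {-1..1})) h :: ennreal)"
      by (simp add: indicator_def)
  qed simp
  also have "\<dots> = of_nat n * emeasure (lebesgue_Rn n) (Pi\<^sub>E {..<n} (\<lambda>_. {-1..1}))"
    by (rule nn_integral_cmult_indicator, rule sets_PiM_I_finite) simp_all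
  also have "\<dots> = of_nat n * (\<Prod>i<n. emeasure lborel {-1..1::real})"
    by (subst emeasure_PiM) simp_all
  also have "\<dots> = ennreal (real n * 2 ^ n)"
    by (simp add: ennreal_mult ennreal_of_nat_eq_real_of_nat flip: ennreal_power)
  finally show ?thesis
    by (rule le_less_trans) simp
qed

text \<open>Substitute r = |h| s: the Jacobian |h| and the factor |h|^(n-1) from the weight combine
  to |h|^n.\<close>

lemma nn_integral_ray_rescale:
  assumes [measurable]: "\<phi> \<in> borel_measurable (lebesgue_Rn n)"
    and h: "vnorm n h > 0" "h \<in> Rn n"
  shows "(\<integral>\<^sup>+r. indicator {0<..} r * ennreal (r powr (real n - 1)) *
      \<phi> (scale n r (scale n (1 / vnorm n h) h)) \<partial>lborel) =
    (\<integral>\<^sup>+s. indicator {0<..} s * ennreal (s powr (real n - 1) * vnorm n h ^ n) * \<phi> (scale n s h) \<partial>lborel)"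
proof -
  let ?N = "vnorm n h"
  have [measurable]: "(\<lambda>_. h) \<in> borel \<rightarrow>\<^sub>M lebesgue_Rn n"
    using h by (intro measurable_const) simp
  have "(\<integral>\<^sup>+r. indicator {0<..} r * ennreal (r powr (real n - 1)) * \<phi> (scale n (r / ?N) h) \<partial>lborel) =
      ennreal \<bar>?N\<bar> * (\<integral>\<^sup>+s. indicator {0<..} (0 + ?N * s) *
      ennreal ((0 + ?N * s) powr (real n - 1)) * \<phi> (scale n ((0 + ?N * s) / ?N) h) \<partial>lborel)"
    using h by (intro nn_integral_real_affine) auto
  also have "\<dots> = (\<integral>\<^sup>+s. ennreal \<bar>?N\<bar> * (indicator {0<..} (0 + ?N * s) *
      ennreal ((0 + ?N * s) powr (real n - 1)) * \<phi> (scale n ((0 + ?N * s) / ?N) h)) \<partial>lborel)"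
    by (intro nn_integral_cmult[symmetric]) measurable
  also have "\<dots> = (\<integral>\<^sup>+s. indicator {0<..} s * ennreal (s powr (real n - 1) * vnorm n h ^ n) * \<phi> (scale n s h) \<partial>lborel)"
  proof (intro nn_integral_cong)
    fix s :: real
    have "?N * ?N powr (real n - 1) = ?N ^ n"
      using h by (simp add: powr_mult_base powr_realpow)
    then have *: "s > 0 \<Longrightarrow> ?N * (?N * s) powr (real n - 1) = s powr (real n - 1) * ?N ^ n"
      using h by (simp add: powr_mult mult_ac)
    have "s > 0 \<Longrightarrow> ennreal ?N * ennreal ((?N * s) powr (real n - 1)) = ennreal (s powr (real n - 1) * ?N ^ n)"
      using h by (subst ennreal_mult[symmetric]) (simp_all add: *)
    then show "ennreal \<bar>?N\<bar> * (indicator {0<..} (0 + ?N * s) *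
      ennreal ((0 + ?N * s) powr (real n - 1)) * \<phi> (scale n ((0 + ?N * s) / ?N) h)) =
      indicator {0<..} s * ennreal (s powr (real n - 1) * ?N ^ n) * \<phi> (scale n s h)"
      using h by (auto simp: indicator_def zero_less_mult_iff mult.assoc[symmetric])
  qed
  finally show ?thesis by (simp add: scale_scale)
qed

text \<open>The punctured ball is expressed through the norm alone, so that measurability follows by
  composition and a dilation only rescales the argument. The value 0 at 0 encodes the
  puncture.\<close>

definition unit_ball_ind :: "real \<Rightarrow> ennreal" where
  "unit_ball_ind t = indicator {0<..1} t"

lemma measurable_unit_ball_ind [measurable]: "unit_ball_ind \<in> borel_measurable borel"
  unfolding unit_ball_ind_def by measurable

text \<open>Substituting y = s h replaces dh by s^(-n) dy and |h|^n by s^(-n) |y|^n, so the power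
  s^(n-1) becomes s^(-n-1).\<close>

lemma nn_integral_ball_rescale:
  assumes [measurable]: "\<phi> \<in> borel_measurable (lebesgue_Rn n)" and s: "s > 0"
  shows "(\<integral>\<^sup>+h. unit_ball_ind (vnorm n h) * ennreal (s powr (real n - 1) * vnorm n h ^ n) *
      \<phi> (scale n s h) \<partial>lebesgue_Rn n) =
    (\<integral>\<^sup>+y. unit_ball_ind (vnorm n y / s) * ennreal (s powr (- real n - 1) * vnorm n y ^ n) *
      \<phi> y \<partial>lebesgue_Rn n)"
proof -
  let ?L = "lebesgue_Rn n"
  have "s ^ n * (s powr (- real n - 1) * s ^ n) = s powr (real n + ((- real n - 1) + real n))"
    using s by (simp only: powr_add powr_realpow)
  then have *: "s ^ n * (s powr (- real n - 1) * s ^ n) = s powr (real n - 1)"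
    by simp
  have "s ^ n * (s powr (- real n - 1) * (s * vnorm n h) ^ n) =
      (s ^ n * (s powr (- real n - 1) * s ^ n)) * vnorm n h ^ n" for h
    by (simp add: power_mult_distrib)
  then have "s ^ n * (s powr (- real n - 1) * (s * vnorm n h) ^ n) = s powr (real n - 1) * vnorm n h ^ n" for h
    unfolding * .
  then have eq: "ennreal (s ^ n) * ennreal (s powr (- real n - 1) * (s * vnorm n h) ^ n) =
      ennreal (s powr (real n - 1) * vnorm n h ^ n)" for h
    using s by (subst ennreal_mult[symmetric]) auto
  have "(\<integral>\<^sup>+y. unit_ball_ind (vnorm n y / s) * ennreal (s powr (- real n - 1) * vnorm n y ^ n) * \<phi> y \<partial>?L) =
    ennreal (s ^ n) * (\<integral>\<^sup>+h. unit_ball_ind (vnorm n (scale n s h) / s) *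
      ennreal (s powr (- real n - 1) * vnorm n (scale n s h) ^ n) * \<phi> (scale n s h) \<partial>?L)"
    using s by (intro nn_integral_lebesgue_Rn_scale) measurable
  also have "\<dots> = (\<integral>\<^sup>+h. ennreal (s ^ n) * (unit_ball_ind (vnorm n (scale n s h) / s) *
      ennreal (s powr (- real n - 1) * vnorm n (scale n s h) ^ n) * \<phi> (scale n s h)) \<partial>?L)"
    by (intro nn_integral_cmult[symmetric]) measurable
  also have "\<dots> = (\<integral>\<^sup>+h. unit_ball_ind (vnorm n h) * ennreal (s powr (real n - 1) * vnorm n h ^ n) *
      \<phi> (scale n s h) \<partial>?L)"
  proof (intro nn_integral_cong)
    fix h
    have rearrange: "a * (b * c * d) = b * (a * c) * d" for a b c d :: ennreal
      by (simp add: mult_ac)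
    show "ennreal (s ^ n) * (unit_ball_ind (vnorm n (scale n s h) / s) *
        ennreal (s powr (- real n - 1) * vnorm n (scale n s h) ^ n) * \<phi> (scale n s h)) =
      unit_ball_ind (vnorm n h) * ennreal (s powr (real n - 1) * vnorm n h ^ n) * \<phi> (scale n s h)"
      unfolding rearrange using s by (simp add: vnorm_scale eq)
  qed
  finally show ?thesis by (rule sym)
qed

text \<open>For s > 0 the ball condition N/s \<le> 1 reads s \<ge> N, and n N^n s^(-n-1) has
  integral 1 over that range. This is where the normalising factor n of
  \<open>sphere_measure\<close> is absorbed.\<close>

lemma nn_integral_cone_weight:
  assumes n: "n \<ge> 1" and N: "N > 0"
  shows "(\<integral>\<^sup>+s. of_nat n * (indicator {0<..} s * (unit_ball_ind (N / s) *
    ennreal (s powr (- real n - 1) * N ^ n) * c)) \<partial>lborel) = c"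
proof -
  have "(\<integral>\<^sup>+s. of_nat n * (indicator {0<..} s * (unit_ball_ind (N / s) *
      ennreal (s powr (- real n - 1) * N ^ n) * c)) \<partial>lborel) =
    (\<integral>\<^sup>+s. (of_nat n * ennreal (N ^ n) * c) *
      (indicator {N<..} s * ennreal (s powr (- real n - 1))) \<partial>lborel)"
  proof (rule nn_integral_cong_AE)
    show "AE s in lborel. of_nat n * (indicator {0<..} s * (unit_ball_ind (N / s) *
      ennreal (s powr (- real n - 1) * N ^ n) * c)) =
      (of_nat n * ennreal (N ^ n) * c) *
      (indicator {N<..} s * ennreal (s powr (- real n - 1)))"
      \<comment> \<open>The two indicators disagree only at s = N, where the ball condition is an
        equality.\<close>
      using AE_lborel_singleton[of N]
    proof (rule eventually_mono)
      fix s :: real assume s: "s \<noteq> N"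
      have "s > 0 \<Longrightarrow> unit_ball_ind (N / s) = indicator {N<..} s"
        using s N by (auto simp: unit_ball_ind_def indicator_def field_simps)
      moreover have "s \<le> 0 \<Longrightarrow> indicator {N<..} s = (0::ennreal)"
        using N by (auto simp: indicator_def)
      ultimately show "of_nat n * (indicator {0<..} s * (unit_ball_ind (N / s) *
        ennreal (s powr (- real n - 1) * N ^ n) * c)) =
        (of_nat n * ennreal (N ^ n) * c) *
        (indicator {N<..} s * ennreal (s powr (- real n - 1)))"
        using N by (cases "s > 0") (simp_all add: ennreal_mult mult_ac)
    qed
  qed
  also have "\<dots> = (of_nat n * ennreal (N ^ n) * c) *
      (\<integral>\<^sup>+s. indicator {N<..} s * ennreal (s powr (- real n - 1)) \<partial>lborel)"
    by (intro nn_integral_cmult) measurable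
  also have "\<dots> = (of_nat n * ennreal (N ^ n) * c) * ennreal (N powr (- real n) / real n)"
    using nn_integral_powr_tail[of "- real n" N] N n by simp
  also have "\<dots> = (ennreal (real n) * ennreal (N ^ n) * ennreal (N powr (- real n) / real n)) * c"
    by (simp only: mult_ac ennreal_of_nat_eq_real_of_nat)
  also have "ennreal (real n) * ennreal (N ^ n) * ennreal (N powr (- real n) / real n) =
      ennreal (real n * N ^ n * (N powr (- real n) / real n))"
    using N by (simp flip: ennreal_mult)
  also have "real n * N ^ n * (N powr (- real n) / real n) = 1"
    using N n by (simp add: powr_minus powr_realpow field_simps)
  finally show ?thesis by simp
qed

text \<open>
  The sphere measure is an integral over the punctured unit ball. Substituting \<open>r = s \<bar>h\<bar>\<close> on the ray
  through \<open>h\<close> and \<open>y = s h\<close> in the ball leaves the weight \<open>n \<bar>y\<bar>\<^sup>n s\<^sup>-\<^sup>n\<^sup>-\<^sup>1\<close> on \<open>s \<ge> \<bar>y\<bar>\<close>, whose integral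
  over \<open>s\<close> is 1.
\<close>

lemma nn_integral_lebesgue_Rn_polar:
  assumes n: "n \<ge> 1" and \<phi> [measurable]: "\<phi> \<in> borel_measurable (lebesgue_Rn n)"
  shows "(\<integral>\<^sup>+h. \<phi> h \<partial>lebesgue_Rn n) =
    (\<integral>\<^sup>+\<theta>. (\<integral>\<^sup>+r. indicator {0<..} r * ennreal (r powr (real n - 1)) * \<phi> (scale n r \<theta>) \<partial>lborel)
      \<partial>sphere_measure n)"
proof -
  let ?L = "lebesgue_Rn n"
  interpret sigma_finite_measure ?L by (rule sigma_finite_lebesgue_Rn)
  interpret pair_sigma_finite lborel ?L by (rule pair_sigma_finite_lborel_lebesgue_Rn)
  have B: "indicator {h. 0 < vnorm n h \<and> vnorm n h \<le> 1} h = unit_ball_ind (vnorm n h)" for h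
    by (simp add: unit_ball_ind_def indicator_def)
  define U where "U = (\<lambda>\<theta>. \<integral>\<^sup>+r. indicator {0<..} r * ennreal (r powr (real n - 1)) * \<phi> (scale n r \<theta>) \<partial>lborel)"
  have [measurable]: "U \<in> borel_measurable ?L" unfolding U_def by measurable
  have [measurable]: "(\<lambda>s. scale n s h) \<in> borel \<rightarrow>\<^sub>M ?L" if "h \<in> Rn n" for h
    using that by (intro measurable_scale measurable_const) auto
  define F where "F = (\<lambda>h s. of_nat n * (indicator {0<..} s * (unit_ball_ind (vnorm n h) *
      ennreal (s powr (real n - 1) * vnorm n h ^ n) * \<phi> (scale n s h))))"
  define G where "G = (\<lambda>s y. of_nat n * (indicator {0<..} s * (unit_ball_ind (vnorm n y / s) *
      ennreal (s powr (- real n - 1) * vnorm n y ^ n) * \<phi> y)))"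
  have "(\<integral>\<^sup>+\<theta>. U \<theta> \<partial>sphere_measure n) =
      (\<integral>\<^sup>+h. of_nat n * unit_ball_ind (vnorm n h) * U (scale n (1 / vnorm n h) h) \<partial>?L)"
    by (simp only: nn_integral_sphere_measure[OF \<open>U \<in> borel_measurable ?L\<close>] B)
  also have "\<dots> = (\<integral>\<^sup>+h. (\<integral>\<^sup>+s. F h s \<partial>lborel) \<partial>?L)"
  proof (rule nn_integral_cong)
    fix h assume "h \<in> space ?L"
    then have h: "h \<in> Rn n" by simp
    have m [measurable]: "(\<lambda>s. \<phi> (scale n s h)) \<in> borel_measurable borel"
      using h by measurable
    show "of_nat n * unit_ball_ind (vnorm n h) * U (scale n (1 / vnorm n h) h) = (\<integral>\<^sup>+s. F h s \<partial>lborel)"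
    proof (cases "vnorm n h > 0")
      case True
      have "of_nat n * unit_ball_ind (vnorm n h) * U (scale n (1 / vnorm n h) h) =
        of_nat n * unit_ball_ind (vnorm n h) *
        (\<integral>\<^sup>+s. indicator {0<..} s * ennreal (s powr (real n - 1) * vnorm n h ^ n) * \<phi> (scale n s h) \<partial>lborel)"
        unfolding U_def nn_integral_ray_rescale[OF \<phi> True h] ..
      also have "\<dots> = (\<integral>\<^sup>+s. of_nat n * unit_ball_ind (vnorm n h) *
        (indicator {0<..} s * ennreal (s powr (real n - 1) * vnorm n h ^ n) * \<phi> (scale n s h)) \<partial>lborel)"
        by (rule nn_integral_cmult[symmetric]) measurable
      also have "\<dots> = (\<integral>\<^sup>+s. F h s \<partial>lborel)"
        by (simp only: F_def mult_ac)
      finally show ?thesis .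
    qed (simp add: F_def unit_ball_ind_def)
  qed
  also have "\<dots> = (\<integral>\<^sup>+s. (\<integral>\<^sup>+h. F h s \<partial>?L) \<partial>lborel)"
    unfolding F_def by (rule Fubini') measurable
  also have "\<dots> = (\<integral>\<^sup>+s. (\<integral>\<^sup>+y. G s y \<partial>?L) \<partial>lborel)"
  proof (rule nn_integral_cong)
    fix s :: real
    show "(\<integral>\<^sup>+h. F h s \<partial>?L) = (\<integral>\<^sup>+y. G s y \<partial>?L)"
    proof (cases "s > 0")
      case True
      then show ?thesis
        unfolding F_def G_def
        by (simp add: nn_integral_cmult nn_integral_ball_rescale[OF \<phi> True])
    qed (simp add: F_def G_def)
  qed
  also have "\<dots> = (\<integral>\<^sup>+y. (\<integral>\<^sup>+s. G s y \<partial>lborel) \<partial>?L)"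
    unfolding G_def by (rule Fubini'[symmetric]) measurable
  also have "\<dots> = (\<integral>\<^sup>+y. \<phi> y \<partial>?L)"
    using AE_vnorm_pos[OF n]
    by (intro nn_integral_cong_AE, elim eventually_mono) (simp only: G_def nn_integral_cone_weight[OF n])
  finally show ?thesis by (simp only: U_def)
qed

subsection \<open>Directional derivatives\<close>

lemma tendsto_coordinatewiseI:
  fixes g :: "'a \<Rightarrow> 'i \<Rightarrow> 'b::topological_space"
  assumes "\<And>i. ((\<lambda>u. g u i) \<longlongrightarrow> l i) F"
  shows "(g \<longlongrightarrow> l) F"
proof -
  have "limitin (product_topology (\<lambda>i. euclidean) UNIV) g l F"
    using assms by (subst limitin_componentwise) (auto simp: extensional_def)
  then show ?thesis
    by (simp add: euclidean_product_topology)
qed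

text \<open>In the next proof a coordinate moves by \<open>u * \<theta> m\<close>, which may have
  either sign or vanish, so the endpoints carry no order.\<close>

lemma MVT_unordered:
  fixes f :: "real \<Rightarrow> real"
  assumes "\<And>t. (f has_real_derivative f' t) (at t)"
  shows "\<exists>c. \<bar>c - a\<bar> \<le> \<bar>b - a\<bar> \<and> f b - f a = (b - a) * f' c"
proof (cases a b rule: linorder_cases)
  case less
  then obtain c where "a < c" "c < b" "f b - f a = (b - a) * f' c"
    using MVT2[of a b f f'] assms by auto
  then show ?thesis by (intro exI[of _ c]) auto
next
  case equal
  then show ?thesis by (intro exI[of _ a]) auto
next
  case greater
  then obtain c where "b < c" "c < a" "f a - f b = (a - b) * f' c"
    using MVT2[of b a f f'] assms by auto
  then show ?thesis by (intro exI[of _ c]) (auto simp: algebra_simps)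
qed

lemma Rn_upd: "x \<in> Rn n \<Longrightarrow> i < n \<Longrightarrow> x(i := t) \<in> Rn n"
  by (auto simp: Rn_def PiE_def extensional_def)

lemma add_scaled_in_Rn [simp]: "add_scaled n x c h \<in> Rn n"
  by (auto simp: Rn_def add_scaled_def)

lemma add_scaled_0 [simp]: "x \<in> Rn n \<Longrightarrow> add_scaled n x 0 h = x"
  by (auto simp: Rn_def add_scaled_def PiE_def extensional_def fun_eq_iff)

lemma add_scaled_add:
  "add_scaled n x (u + v) \<theta> = add_scaled n (add_scaled n x u \<theta>) v \<theta>"
  by (auto simp: add_scaled_def fun_eq_iff algebra_simps)

lemma continuous_on_add_scaled_line: "continuous_on UNIV (\<lambda>u. add_scaled n x u \<theta>)"
proof (rule continuous_on_coordinatewise_then_product)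
  fix i show "continuous_on UNIV (\<lambda>u. add_scaled n x u \<theta> i)"
    by (cases "i < n") (auto simp: add_scaled_def intro!: continuous_intros)
qed

text \<open>This is the classical derivation of the chain rule from continuous partial derivatives:
  move one coordinate at a time, apply the mean value theorem to each move, and use continuity at
  \<open>x\<close> for the intermediate points.\<close>

lemma has_real_derivative_along_line_0:
  assumes diff: "\<And>i x. i < n \<Longrightarrow> x \<in> Rn n \<Longrightarrow> (\<lambda>t. F (x(i := t))) differentiable (at (x i))"
    and cont: "\<And>i. i < n \<Longrightarrow> continuous_on (Rn n) (partial i F)"
    and x: "x \<in> Rn n"
  shows "((\<lambda>u. F (add_scaled n x u \<theta>)) has_real_derivative
      (\<Sum>i<n. partial i F x * \<theta> i)) (at 0)"
proof -
  \<comment> \<open>Only the first \<open>m\<close> coordinates have moved, so \<open>p 0 u\<close>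
    is \<open>x\<close> and \<open>p n u\<close> is the point on the line.\<close>
  define p where "p = (\<lambda>m u. (\<lambda>i\<in>{..<n}. x i + (if i < m then u * \<theta> i else 0)))"
  have pRn: "p m u \<in> Rn n" for m u by (auto simp: p_def Rn_def)
  have p0: "p m 0 = x" for m
    using x by (auto simp: p_def Rn_def PiE_def extensional_def fun_eq_iff)
  have "((\<lambda>u. F (p m u)) has_real_derivative (\<Sum>i<m. partial i F x * \<theta> i)) (at 0)" if "m \<le> n" for m
    using that
  proof (induction m)
    case 0
    have "p 0 u = x" for u
      using x by (auto simp: p_def Rn_def PiE_def extensional_def fun_eq_iff)
    then show ?case by simp
  next
    case (Suc m)
    then have m: "m < n" by simp
    have pm: "p m u m = x m" for u using m by (simp add: p_def)
    have pSuc: "p (Suc m) u = (p m u)(m := x m + u * \<theta> m)" for u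
      using m by (auto simp: p_def fun_eq_iff)
    have D: "((\<lambda>t. F (y(m := t))) has_real_derivative partial m F (y(m := t))) (at t)"
      if "y \<in> Rn n" for y t
      using diff[OF m Rn_upd[OF that m], of t]
      by (simp add: partial_def differentiable_def DERIV_deriv_iff_real_differentiable)
    \<comment> \<open>The points \<open>p m u\<close> and \<open>p (Suc m) u\<close> differ only in
      coordinate \<open>m\<close>, so this is a mean value step in one variable.\<close>
    have "\<exists>c. \<bar>c - x m\<bar> \<le> \<bar>u * \<theta> m\<bar> \<and>
        F (p (Suc m) u) - F (p m u) = u * \<theta> m * partial m F ((p m u)(m := c))" for u
      using MVT_unordered[OF D[OF pRn[of m u]], of "x m" "x m + u * \<theta> m"] pm
      by (metis add_diff_cancel_left' fun_upd_triv pSuc)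
    then obtain c where c: "\<And>u. \<bar>c u - x m\<bar> \<le> \<bar>u * \<theta> m\<bar>"
      "\<And>u. F (p (Suc m) u) - F (p m u) = u * \<theta> m * partial m F ((p m u)(m := c u))"
      by metis
    have lim_c: "(c \<longlongrightarrow> x m) (at 0)"
    proof -
      have "((\<lambda>u. \<bar>u * \<theta> m\<bar>) \<longlongrightarrow> \<bar>0 * \<theta> m\<bar>) (at 0)"
        by (intro tendsto_intros)
      then have "((\<lambda>u. c u - x m) \<longlongrightarrow> 0) (at 0)"
        using c(1) by (intro Lim_null_comparison[of "\<lambda>u. c u - x m" "\<lambda>u. \<bar>u * \<theta> m\<bar>"]) auto
      then show ?thesis by (simp add: LIM_zero_iff)
    qed
    have "((\<lambda>u. (p m u)(m := c u)) \<longlongrightarrow> x) (at 0)"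
    proof (rule tendsto_coordinatewiseI)
      fix i
      have "((\<lambda>u. x i + u * \<theta> i) \<longlongrightarrow> x i + 0 * \<theta> i) (at 0)"
        by (intro tendsto_intros)
      moreover have "i \<notin> {..<n} \<Longrightarrow> x i = undefined"
        using x by (auto simp: Rn_def PiE_def extensional_def)
      ultimately show "((\<lambda>u. ((p m u)(m := c u)) i) \<longlongrightarrow> x i) (at 0)"
        using lim_c m by (cases "i = m"; cases "i < m"; cases "i < n") (simp_all add: p_def)
    qed
    then have lim: "((\<lambda>u. partial m F ((p m u)(m := c u))) \<longlongrightarrow> partial m F x) (at 0)"
      by (intro continuous_on_tendsto_compose[OF cont[OF m]] x)
         (auto intro!: always_eventually Rn_upd pRn m)
    \<comment> \<open>The increment vanishes at u = 0, and for other u its difference quotient is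
      exactly \<theta> m times the partial derivative at the intermediate point.\<close>
    have "((\<lambda>u. F (p (Suc m) u) - F (p m u)) has_real_derivative \<theta> m * partial m F x) (at 0)"
      unfolding has_field_derivative_iff
    proof (rule Lim_transform_eventually)
      show "((\<lambda>u. \<theta> m * partial m F ((p m u)(m := c u))) \<longlongrightarrow> \<theta> m * partial m F x) (at 0)"
        by (intro tendsto_intros lim)
      show "\<forall>\<^sub>F u in at 0. \<theta> m * partial m F ((p m u)(m := c u)) =
          (F (p (Suc m) u) - F (p m u) - (F (p (Suc m) 0) - F (p m 0))) / (u - 0)"
        by (auto simp: eventually_at_filter p0 c(2))
    qed
    from DERIV_add[OF this Suc.IH] m show ?case
      by (simp add: algebra_simps)
  qed
  from this[of n] show ?thesis
    by (simp add: p_def add_scaled_def restrict_def cong: if_cong)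
qed

lemma has_real_derivative_along_line:
  assumes "\<And>i x. i < n \<Longrightarrow> x \<in> Rn n \<Longrightarrow> (\<lambda>t. F (x(i := t))) differentiable (at (x i))"
    and "\<And>i. i < n \<Longrightarrow> continuous_on (Rn n) (partial i F)"
  shows "((\<lambda>u. F (add_scaled n x u \<theta>)) has_real_derivative
      (\<Sum>i<n. partial i F (add_scaled n x u \<theta>) * \<theta> i)) (at u)"
proof -
  have "((\<lambda>v. F (add_scaled n (add_scaled n x u \<theta>) v \<theta>)) has_real_derivative
      (\<Sum>i<n. partial i F (add_scaled n x u \<theta>) * \<theta> i)) (at 0)"
    by (intro has_real_derivative_along_line_0 assms) auto
  then have "((\<lambda>v. F (add_scaled n x (v + u) \<theta>)) has_real_derivative
      (\<Sum>i<n. partial i F (add_scaled n x u \<theta>) * \<theta> i)) (at 0)"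
    by (simp add: add_scaled_add add.commute[of _ u])
  then show ?thesis
    using DERIV_shift[of "\<lambda>u. F (add_scaled n x u \<theta>)" _ 0 u] by simp
qed

abbreviation index_lists :: "nat \<Rightarrow> nat \<Rightarrow> nat list set" where
  "index_lists n k \<equiv> {is. length is = k \<and> set is \<subseteq> {..<n}}"

text \<open>The head of an index list is the derivative applied last, so splitting it off exposes
  the outermost differentiation.\<close>

lemma sum_index_lists_Suc:
  "(\<Sum>is\<in>index_lists n (Suc k). h is) = (\<Sum>is\<in>index_lists n k. \<Sum>i<n. h (i # is))"
proof -
  have eq: "index_lists n (Suc k) = (\<lambda>(is, i). i # is) ` (index_lists n k \<times> {..<n})"
    by (auto simp: length_Suc_conv image_iff)
  have inj: "inj_on (\<lambda>(is, i). i # is) (index_lists n k \<times> {..<n})"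
    by (auto simp: inj_on_def)
  show ?thesis
    unfolding eq sum.reindex[OF inj]
    by (simp add: sum.cartesian_product case_prod_unfold)
qed

lemma Ddir_altdef:
  "Ddir n k \<theta> f x = (\<Sum>is\<in>index_lists n k. partials is f x * (\<Prod>j<k. \<theta> (is ! j)))"
  unfolding Ddir_def Dform_def by (intro sum.cong refl) auto

lemma Ddir_Suc:
  "Ddir n (Suc k) \<theta> f x =
    (\<Sum>is\<in>index_lists n k. (\<Sum>i<n. partials (i # is) f x * \<theta> i) * (\<Prod>j<k. \<theta> (is ! j)))"
  unfolding Ddir_altdef sum_index_lists_Suc
  by (intro sum.cong refl) (simp add: sum_distrib_right sum_distrib_left prod.lessThan_Suc_shift algebra_simps del: prod.lessThan_Suc)

text \<open>The chain rule along the line, applied to each summand, puts a new index at the head of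
  the list together with a factor \<theta> i; by \<open>Ddir_Suc\<close> the result is the form of
  the next order.\<close>

lemma Ddir_has_real_derivative:
  assumes "Ck n k f" "j < k"
  shows "((\<lambda>u. Ddir n j \<theta> f (add_scaled n x u \<theta>)) has_real_derivative
      Ddir n (Suc j) \<theta> f (add_scaled n x u \<theta>)) (at u)"
proof -
  have "((\<lambda>u. partials is f (add_scaled n x u \<theta>)) has_real_derivative
      (\<Sum>i<n. partials (i # is) f (add_scaled n x u \<theta>) * \<theta> i)) (at u)"
    if "is \<in> index_lists n j" for "is"
  proof -
    have "continuous_on (Rn n) (partials (i # is) f)" if "i < n" for i
      using assms \<open>is \<in> index_lists n j\<close> that
      unfolding Ck_def by (elim conjE allE[of _ "i # is"]) auto
    then show ?thesis
      unfolding partials.simps using assms that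
      by (intro has_real_derivative_along_line) (auto simp: Ck_def simp del: fun_upd_apply)
  qed
  then show ?thesis
    unfolding Ddir_altdef[of n j] Ddir_Suc
    by (intro DERIV_sum DERIV_cmult_right)
qed

lemma Ddir_0 [simp]: "Ddir n 0 \<theta> f x = f x"
proof -
  have "index_lists n 0 = {[]}" by auto
  then show ?thesis by (simp add: Ddir_altdef)
qed

lemma Ck_continuous: "Ck n k f \<Longrightarrow> set is \<subseteq> {..<n} \<Longrightarrow> length is \<le> k \<Longrightarrow> continuous_on (Rn n) (partials is f)"
  by (simp add: Ck_def)

lemma continuous_on_Ddir_line:
  assumes "Ck n k f"
  shows "continuous_on UNIV (\<lambda>u. Ddir n k \<theta> f (add_scaled n x u \<theta>))"
  unfolding Ddir_altdef
  by (intro continuous_intros continuous_on_compose2[OF Ck_continuous[OF assms]]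
      continuous_on_add_scaled_line) auto

section \<open>Compact support and bounds on derivatives\<close>

lemma partials_eq_0:
  assumes "closed C" "\<And>y. y \<in> Rn n \<Longrightarrow> y \<notin> C \<Longrightarrow> f y = 0"
    and "set is \<subseteq> {..<n}" "y \<in> Rn n" "y \<notin> C"
  shows "partials is f y = 0"
  using assms(3-)
proof (induction "is" arbitrary: y)
  case Nil
  then show ?case using assms by simp
next
  case (Cons i "is")
  have "continuous_on UNIV (\<lambda>t. y(i := t))"
  proof (rule continuous_on_coordinatewise_then_product)
    show "continuous_on UNIV (\<lambda>t. (y(i := t)) j)" for j
      by (cases "j = i") auto
  qed
  then have "((\<lambda>t. y(i := t)) \<longlongrightarrow> y(i := y i)) (at (y i))"
    unfolding continuous_on_def by blast
  then have "\<forall>\<^sub>F t in at (y i). y(i := t) \<in> - C"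
    using Cons.prems assms(1) by (intro topological_tendstoD[where l = y]) auto
  \<comment> \<open>The full neighbourhood includes the point itself; there the lower derivative is
    locally zero by the induction hypothesis, hence so is its derivative.\<close>
  then have "\<forall>\<^sub>F t in nhds (y i). y(i := t) \<in> - C"
    using Cons.prems by (auto simp: eventually_nhds_conv_at)
  then have "\<forall>\<^sub>F t in nhds (y i). partials is f (y(i := t)) = 0"
    by eventually_elim (use Cons in \<open>auto intro!: Cons.IH Rn_upd\<close>)
  then have "deriv (\<lambda>t. partials is f (y(i := t))) (y i) = deriv (\<lambda>t. 0) (y i)"
    by (intro deriv_cong_ev) auto
  then show ?case by (simp add: partial_def)
qed

text \<open>The closure of the nonvanishing set, taken among all functions on the naturals, thereby
  stays inside \<open>Rn n\<close>, where the partial derivatives are continuous.\<close>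

lemma closed_Rn: "closed (Rn n)"
proof -
  have "Rn n = (\<Inter>i\<in>- {..<n}. (\<lambda>x. x i) -` {undefined})"
    by (auto simp: Rn_def PiE_def extensional_def)
  moreover have "closed ((\<lambda>x::nat \<Rightarrow> real. x i) -` {undefined})" for i
    by (intro closed_vimage) auto
  ultimately show ?thesis by auto
qed

lemma bounded_partials:
  assumes "Ck_compact n k f" "set is \<subseteq> {..<n}" "length is \<le> k"
  shows "\<exists>B\<ge>0. \<forall>y\<in>Rn n. \<bar>partials is f y\<bar> \<le> B"
proof -
  define C where "C = closure {x \<in> Rn n. f x \<noteq> 0}"
  have C: "compact C" "C \<subseteq> Rn n"
    using assms closed_Rn[of n] unfolding C_def Ck_compact_def
    using closure_minimal[of "{x \<in> Rn n. f x \<noteq> 0}" "Rn n"] by auto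
  have "continuous_on C (partials is f)"
    using assms C Ck_continuous continuous_on_subset unfolding Ck_compact_def by blast
  then have "compact (partials is f ` C)"
    using C compact_continuous_image by blast
  then obtain B where B: "\<And>y. y \<in> C \<Longrightarrow> \<bar>partials is f y\<bar> \<le> B"
    by (force dest!: compact_imp_bounded simp: bounded_iff)
  have "partials is f y = 0" if "y \<in> Rn n" "y \<notin> C" for y
  proof (rule partials_eq_0[of C n])
    show "closed C" by (simp add: C_def)
    show "f y = 0" if "y \<in> Rn n" "y \<notin> C" for y
      using that closure_subset[of "{x \<in> Rn n. f x \<noteq> 0}"] by (auto simp: C_def)
  qed (use assms that in auto)
  with B show ?thesis
    \<comment> \<open>The maximum with 0 ensures nonnegativity and covers the points outside
      \<open>C\<close>, where the derivative is 0.\<close>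
    by (intro exI[of _ "max B 0"]) (metis abs_zero max.cobounded2 max.coboundedI1)
qed

lemma Ddir_bounded:
  assumes "Ck_compact n k f"
  shows "\<exists>K>0. \<forall>y\<in>Rn n. \<forall>\<theta>. vnorm n \<theta> \<le> 1 \<longrightarrow> \<bar>Ddir n k \<theta> f y\<bar> \<le> K"
proof -
  have "\<exists>B. \<forall>is\<in>index_lists n k. B is \<ge> 0 \<and> (\<forall>y\<in>Rn n. \<bar>partials is f y\<bar> \<le> B is)"
    using bounded_partials[OF assms] by (intro bchoice) auto
  then obtain B where B: "\<And>is. is \<in> index_lists n k \<Longrightarrow> B is \<ge> 0"
    "\<And>is y. is \<in> index_lists n k \<Longrightarrow> y \<in> Rn n \<Longrightarrow> \<bar>partials is f y\<bar> \<le> B is"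
    by auto
  show ?thesis
  \<comment> \<open>The summand 1 makes the bound strictly positive even if all \<open>B is\<close>
    vanish.\<close>
  proof (intro exI[of _ "1 + (\<Sum>is\<in>index_lists n k. B is)"] conjI ballI allI impI)
    show "1 + (\<Sum>is\<in>index_lists n k. B is) > 0"
      using B(1) by (smt (verit) sum_nonneg)
    fix y \<theta> assume y: "y \<in> Rn n" and \<theta>: "vnorm n \<theta> \<le> 1"
    have "\<bar>Ddir n k \<theta> f y\<bar> \<le> (\<Sum>is\<in>index_lists n k. \<bar>partials is f y * (\<Prod>j<k. \<theta> (is ! j))\<bar>)"
      unfolding Ddir_altdef by (rule sum_abs)
    also have "\<dots> \<le> (\<Sum>is\<in>index_lists n k. B is)"
    proof (intro sum_mono)
      fix "is" assume i: "is \<in> index_lists n k"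
      have "\<bar>\<theta> (is ! j)\<bar> \<le> 1" if "j < k" for j
      proof -
        have "is ! j < n" using i that nth_mem by fastforce
        then show ?thesis using abs_coord_le_vnorm[of "is ! j" n \<theta>] \<theta> by simp
      qed
      then have "(\<Prod>j<k. \<bar>\<theta> (is ! j)\<bar>) \<le> 1"
        by (intro prod_le_1) auto
      then have "\<bar>partials is f y\<bar> * (\<Prod>j<k. \<bar>\<theta> (is ! j)\<bar>) \<le> B is * 1"
        using B i y by (intro mult_mono) (auto intro: prod_nonneg)
      then show "\<bar>partials is f y * (\<Prod>j<k. \<theta> (is ! j))\<bar> \<le> B is"
        by (simp add: abs_mult abs_prod)
    qed
    finally show "\<bar>Ddir n k \<theta> f y\<bar> \<le> 1 + (\<Sum>is\<in>index_lists n k. B is)" by simp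
  qed
qed

subsection \<open>Integrals along a ray\<close>

lemma epowr_mult:
  assumes "c > 0"
  shows "epowr (ennreal c * a) p = ennreal (c powr p) * epowr a p"
proof (cases a)
  case (real b)
  then have "ennreal c * a = ennreal (c * b)"
    using assms by (simp add: ennreal_mult)
  then have "epowr (ennreal c * a) p = ennreal ((c * b) powr p)"
    using real assms by (simp add: epowr_def del: ennreal_mult')
  with real assms show ?thesis
    by (simp add: epowr_def powr_mult ennreal_mult)
qed (use assms in \<open>simp add: epowr_def ennreal_mult_top\<close>)

lemma epowr_mono:
  assumes "a \<le> b" "p > 0"
  shows "epowr a p \<le> epowr b p"
proof (cases "b = \<infinity>")
  case False
  then have "a \<noteq> \<infinity>" using assms by (auto simp: top_unique)
  moreover have "enn2real a \<le> enn2real b"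
    using False assms by (intro enn2real_mono) (auto simp: less_top)
  ultimately show ?thesis
    using False assms by (auto simp: epowr_def intro!: ennreal_leI powr_mono2)
qed (simp add: epowr_def)

text \<open>Since the limit is finite, \<open>X\<close> is eventually finite, and there
  \<open>epowr\<close> is the continuous real power.\<close>

lemma tendsto_epowr:
  assumes "(X \<longlongrightarrow> L) F" "L \<noteq> \<infinity>" "p > 0"
  shows "((\<lambda>i. epowr (X i) p) \<longlongrightarrow> epowr L p) F"
proof -
  have "((\<lambda>i. ennreal (enn2real (X i) powr p)) \<longlongrightarrow> ennreal (enn2real L powr p)) F"
    using assms
    by (intro tendsto_ennrealI tendsto_powr' tendsto_enn2real tendsto_const) (auto simp: less_top)
  moreover have "\<forall>\<^sub>F i in F. ennreal (enn2real (X i) powr p) = epowr (X i) p"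
  proof (rule eventually_mono)
    show "\<forall>\<^sub>F i in F. X i < \<infinity>"
      using assms by (intro order_tendstoD(2)[OF assms(1)]) (simp add: less_top)
  qed (simp add: epowr_def)
  ultimately have "((\<lambda>i. epowr (X i) p) \<longlongrightarrow> ennreal (enn2real L powr p)) F"
    by (rule Lim_transform_eventually)
  then show ?thesis
    using assms(2) by (simp add: epowr_def)
qed

text \<open>The weight r^(\<gamma>-1) is the polar Jacobian r^(n-1) times r^(\<gamma>-n), so the
  dimension drops out.\<close>

definition ray_int :: "real \<Rightarrow> real \<Rightarrow> real \<Rightarrow> (real \<Rightarrow> real) \<Rightarrow> ennreal" where
  "ray_int \<gamma> q lam D =
    (\<integral>\<^sup>+r. indicator {r. 0 < r \<and> lam * r powr (\<gamma> / q) < D r} r * ennreal (r powr (\<gamma> - 1)) \<partial>lborel)"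

lemma ray_int_mono:
  assumes "\<And>r. r > 0 \<Longrightarrow> D r \<le> D' r"
  shows "ray_int \<gamma> q lam D \<le> ray_int \<gamma> q lam D'"
  unfolding ray_int_def
proof (intro nn_integral_mono mult_right_mono)
  fix r
  show "indicator {r. 0 < r \<and> lam * r powr (\<gamma> / q) < D r} r \<le>
      (indicator {r. 0 < r \<and> lam * r powr (\<gamma> / q) < D' r} r :: ennreal)"
    using assms[of r] by (auto simp: indicator_def)
qed simp

lemma powr_less_iff_less_powr_inverse:
  assumes "r > 0" "b > 0" "a > (0::real)"
  shows "r powr a < b \<longleftrightarrow> r < b powr (1 / a)"
proof -
  have "r powr a < b \<longleftrightarrow> a * ln r < ln b"
    using assms by (subst ln_less_cancel_iff [symmetric]) (simp_all add: ln_powr)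
  also have "\<dots> \<longleftrightarrow> ln r < ln (b powr (1 / a))"
    using assms by (simp add: ln_powr field_simps)
  also have "\<dots> \<longleftrightarrow> r < b powr (1 / a)"
    using assms by (subst ln_less_cancel_iff) simp_all
  finally show ?thesis .
qed

lemma powr_less_iff_powr_inverse_less:
  assumes "r > 0" "b > 0" "a < (0::real)"
  shows "r powr a < b \<longleftrightarrow> b powr (1 / a) < r"
proof -
  have "r powr a < b \<longleftrightarrow> a * ln r < ln b"
    using assms by (subst ln_less_cancel_iff [symmetric]) (simp_all add: ln_powr)
  also have "\<dots> \<longleftrightarrow> ln (b powr (1 / a)) < ln r"
    using assms by (simp add: ln_powr field_simps)
  also have "\<dots> \<longleftrightarrow> b powr (1 / a) < r"
    using assms by (subst ln_less_cancel_iff) simp_all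
  finally show ?thesis .
qed

text \<open>With c = (a / lam)^(q/\<gamma>), the level set is the interval below c for \<gamma> > 0
  and the half-line above c for \<gamma> < 0. Both integrals equal c^\<gamma> / |\<gamma>|, and
  c^\<gamma> = (a / lam)^q.\<close>

lemma ray_int_const:
  assumes "\<gamma> \<noteq> 0" "q > 0" "lam > 0" "a \<ge> 0"
  shows "ray_int \<gamma> q lam (\<lambda>_. a) = ennreal ((a / lam) powr q / \<bar>\<gamma>\<bar>)"
proof (cases "a = 0")
  case True
  have "{r. 0 < r \<and> lam * r powr (\<gamma> / q) < a} = {}"
    using assms True by (auto simp: not_less)
  then show ?thesis
    using True by (simp add: ray_int_def)
next
  case False
  define c where "c = (a / lam) powr (1 / (\<gamma> / q))"
  have a: "a / lam > 0" using assms False by simp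
  have c: "c > 0" using assms False by (simp add: c_def)
  have c_powr: "c powr \<gamma> = (a / lam) powr q"
    using assms by (simp add: c_def powr_powr)
  have iff: "lam * r powr (\<gamma> / q) < a \<longleftrightarrow> r powr (\<gamma> / q) < a / lam" for r
    using assms by (simp add: field_simps)
  show ?thesis
  proof (cases "\<gamma> > 0")
    case True
    have "(0 < r \<and> lam * r powr (\<gamma> / q) < a) \<longleftrightarrow> r \<in> {0<..<c}" for r
      using powr_less_iff_less_powr_inverse[OF _ a, of r "\<gamma> / q"] True \<open>q > 0\<close>
      unfolding iff c_def by (cases "r > 0") simp_all
    then have "{r. 0 < r \<and> lam * r powr (\<gamma> / q) < a} = {0<..<c}"
      by blast
    then show ?thesis
      using nn_integral_powr_near_0[of \<gamma> c] True c c_powr by (simp add: ray_int_def)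
  next
    case False
    then have neg: "\<gamma> < 0" using assms by simp
    then have "\<gamma> / q < 0" using assms by (simp add: divide_neg_pos)
    then have "(0 < r \<and> lam * r powr (\<gamma> / q) < a) \<longleftrightarrow> r > c" for r
      using powr_less_iff_powr_inverse_less[OF _ a, of r "\<gamma> / q", folded c_def] c
      unfolding iff by (cases "r > 0") auto
    then have "{r. 0 < r \<and> lam * r powr (\<gamma> / q) < a} = {c<..}"
      by blast
    then show ?thesis
      using nn_integral_powr_tail[of \<gamma> c] neg c c_powr by (simp add: ray_int_def)
  qed
qed

text \<open>Under r = \<epsilon> s the chosen level turns the threshold into s^(\<gamma>/q); the
  Jacobian \<epsilon> and the factor \<epsilon>^(\<gamma>-1) of the weight cancel
  \<epsilon>^(-\<gamma>).\<close>

lemma ray_int_rescale: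
  assumes \<epsilon>: "\<epsilon> > 0" and [measurable]: "D \<in> borel_measurable borel"
  shows "ennreal (\<epsilon> powr (-\<gamma>)) * ray_int \<gamma> q (\<epsilon> powr (-\<gamma> / q)) D = ray_int \<gamma> q 1 (\<lambda>s. D (\<epsilon> * s))"
proof -
  let ?l = "\<epsilon> powr (-\<gamma> / q)"
  have "ray_int \<gamma> q ?l D = ennreal \<bar>\<epsilon>\<bar> * (\<integral>\<^sup>+s. indicator {r. 0 < r \<and> ?l * r powr (\<gamma> / q) < D r} (0 + \<epsilon> * s) *
      ennreal ((0 + \<epsilon> * s) powr (\<gamma> - 1)) \<partial>lborel)"
    unfolding ray_int_def using \<epsilon> by (intro nn_integral_real_affine) auto
  also have "(\<integral>\<^sup>+s. indicator {r. 0 < r \<and> ?l * r powr (\<gamma> / q) < D r} (0 + \<epsilon> * s) *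
      ennreal ((0 + \<epsilon> * s) powr (\<gamma> - 1)) \<partial>lborel) = (\<integral>\<^sup>+s. ennreal (\<epsilon> powr (\<gamma> - 1)) *
      (indicator {r. 0 < r \<and> 1 * r powr (\<gamma> / q) < D (\<epsilon> * r)} s * ennreal (s powr (\<gamma> - 1))) \<partial>lborel)"
  proof (rule nn_integral_cong)
    fix s :: real
    have "?l * (\<epsilon> * s) powr (\<gamma> / q) = s powr (\<gamma> / q)" if "s > 0"
      using \<epsilon> that by (simp add: powr_mult flip: mult.assoc powr_add)
    then have iff: "(0 < 0 + \<epsilon> * s \<and> ?l * (0 + \<epsilon> * s) powr (\<gamma> / q) < D (0 + \<epsilon> * s)) \<longleftrightarrow>
        (0 < s \<and> 1 * s powr (\<gamma> / q) < D (\<epsilon> * s))"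
      using \<epsilon> by (cases "s > 0") (simp_all add: zero_less_mult_iff)
    have pw: "s > 0 \<Longrightarrow> ennreal ((0 + \<epsilon> * s) powr (\<gamma> - 1)) = ennreal (\<epsilon> powr (\<gamma> - 1)) * ennreal (s powr (\<gamma> - 1))"
      using \<epsilon> by (simp add: powr_mult ennreal_mult)
    show "indicator {r. 0 < r \<and> ?l * r powr (\<gamma> / q) < D r} (0 + \<epsilon> * s) *
        ennreal ((0 + \<epsilon> * s) powr (\<gamma> - 1)) = ennreal (\<epsilon> powr (\<gamma> - 1)) *
      (indicator {r. 0 < r \<and> 1 * r powr (\<gamma> / q) < D (\<epsilon> * r)} s * ennreal (s powr (\<gamma> - 1)))"
      unfolding indicator_def mem_Collect_eq iff using pw
      by (cases "0 < s \<and> 1 * s powr (\<gamma> / q) < D (\<epsilon> * s)") simp_all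
  qed
  also have "\<dots> = ennreal (\<epsilon> powr (\<gamma> - 1)) * ray_int \<gamma> q 1 (\<lambda>s. D (\<epsilon> * s))"
    unfolding ray_int_def by (rule nn_integral_cmult) measurable
  finally have "ennreal (\<epsilon> powr (-\<gamma>)) * ray_int \<gamma> q ?l D =
      ennreal (\<epsilon> powr (-\<gamma>)) * ennreal \<epsilon> * ennreal (\<epsilon> powr (\<gamma> - 1)) * ray_int \<gamma> q 1 (\<lambda>s. D (\<epsilon> * s))"
    using \<epsilon> by (simp only: mult.assoc abs_of_pos)
  also have "ennreal (\<epsilon> powr (-\<gamma>)) * ennreal \<epsilon> * ennreal (\<epsilon> powr (\<gamma> - 1)) =
      ennreal (\<epsilon> powr (-\<gamma>) * \<epsilon> * \<epsilon> powr (\<gamma> - 1))"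
    using \<epsilon> by (simp flip: ennreal_mult)
  also have "\<epsilon> powr (-\<gamma>) * \<epsilon> * \<epsilon> powr (\<gamma> - 1) = \<epsilon> powr (-\<gamma> + 1 + (\<gamma> - 1))"
    using \<epsilon> by (simp only: powr_add powr_one)
  finally show ?thesis using \<epsilon> by simp
qed

text \<open>This excludes the single point where the limiting threshold is attained with equality
  and the indicators may fail to converge.\<close>

lemma AE_powr_neq:
  fixes p a :: real
  assumes "p \<noteq> 0"
  shows "AE s in lborel. s > 0 \<longrightarrow> s powr p \<noteq> a"
  using AE_lborel_singleton[of "a powr (1 / p)"]
proof (rule eventually_mono)
  fix s :: real assume s: "s \<noteq> a powr (1 / p)"
  show "s > 0 \<longrightarrow> s powr p \<noteq> a"
  proof (intro impI notI)
    assume "s > 0" "s powr p = a"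
    then have "a powr (1 / p) = s" using assms by (auto simp: powr_powr)
    with s show False by simp
  qed
qed

text \<open>Dominated convergence on the ray: the bound \<open>K\<close> puts every level set inside
  that of the constant \<open>K\<close>, whose weighted integral is finite by
  \<open>ray_int_const\<close>.\<close>

lemma ray_int_tendsto:
  assumes \<gamma>: "\<gamma> \<noteq> 0" and q: "q > 0" and [measurable]: "D \<in> borel_measurable borel"
    and bound: "\<And>r. r > 0 \<Longrightarrow> D r \<le> K" and "K \<ge> 0"
    and lim: "(D \<longlongrightarrow> a) (at_right 0)"
    and X: "\<And>i. X i > 0" "X \<longlonglongrightarrow> 0"
  shows "(\<lambda>i. ray_int \<gamma> q 1 (\<lambda>s. D (X i * s))) \<longlonglongrightarrow> ray_int \<gamma> q 1 (\<lambda>_. a)"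
  unfolding ray_int_def
proof (rule nn_integral_dominated_convergence)
  let ?w = "\<lambda>r. indicator {r. 0 < r \<and> 1 * r powr (\<gamma> / q) < K} r * ennreal (r powr (\<gamma> - 1))"
  show "?w \<in> borel_measurable lborel" by measurable
  show "(\<lambda>s. indicator {r. 0 < r \<and> 1 * r powr (\<gamma> / q) < a} s * ennreal (s powr (\<gamma> - 1)))
      \<in> borel_measurable lborel" by measurable
  show "(\<lambda>s. indicator {r. 0 < r \<and> 1 * r powr (\<gamma> / q) < D (X i * r)} s * ennreal (s powr (\<gamma> - 1)))
      \<in> borel_measurable lborel" for i by measurable
  show "(\<integral>\<^sup>+r. ?w r \<partial>lborel) < \<infinity>"
    using ray_int_const[OF \<gamma> q _ \<open>K \<ge> 0\<close>, of 1] by (simp add: ray_int_def)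
  show "AE s in lborel. indicator {r. 0 < r \<and> 1 * r powr (\<gamma> / q) < D (X j * r)} s *
      ennreal (s powr (\<gamma> - 1)) \<le> ?w s" for j
  proof (intro AE_I2 mult_right_mono)
    fix s :: real
    have "D (X j * s) \<le> K" if "s > 0"
      using bound[of "X j * s"] X(1)[of j] that by simp
    then show "indicator {r. 0 < r \<and> 1 * r powr (\<gamma> / q) < D (X j * r)} s \<le>
        (indicator {r. 0 < r \<and> 1 * r powr (\<gamma> / q) < K} s :: ennreal)"
      by (auto simp: indicator_def)
  qed simp
  have "\<gamma> / q \<noteq> 0" using \<gamma> q by simp
  from AE_powr_neq[OF this]
  show "AE s in lborel. (\<lambda>i. indicator {r. 0 < r \<and> 1 * r powr (\<gamma> / q) < D (X i * r)} s *
      ennreal (s powr (\<gamma> - 1))) \<longlonglongrightarrow>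
      indicator {r. 0 < r \<and> 1 * r powr (\<gamma> / q) < a} s * ennreal (s powr (\<gamma> - 1))"
  proof (rule eventually_mono)
    fix s :: real assume s: "s > 0 \<longrightarrow> s powr (\<gamma> / q) \<noteq> a"
    \<comment> \<open>Off the exceptional point the limit lies strictly on one side of the
      threshold, so membership is eventually constant in \<open>i\<close>.\<close>
    have "\<forall>\<^sub>F i in sequentially. (0 < s \<and> 1 * s powr (\<gamma> / q) < D (X i * s)) \<longleftrightarrow>
        (0 < s \<and> 1 * s powr (\<gamma> / q) < a)"
    proof (cases "s > 0")
      case True
      have "(\<lambda>i. X i * s) \<longlonglongrightarrow> 0 * s"
        by (intro tendsto_intros X)
      then have "filterlim (\<lambda>i. X i * s) (at_right 0) sequentially"
        using X(1) True by (intro tendsto_imp_filterlim_at_right) simp_all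
      then have D: "(\<lambda>i. D (X i * s)) \<longlonglongrightarrow> a"
        by (rule filterlim_compose[OF lim])
      show ?thesis
      proof (cases "s powr (\<gamma> / q) < a")
        case True
        then show ?thesis
          using order_tendstoD(1)[OF D True] by (auto elim!: eventually_mono)
      next
        case False
        with s \<open>s > 0\<close> have "a < s powr (\<gamma> / q)" by auto
        then show ?thesis
          using order_tendstoD(2)[OF D, of "s powr (\<gamma> / q)"] by (auto elim!: eventually_mono)
      qed
    qed simp
    then show "(\<lambda>i. indicator {r. 0 < r \<and> 1 * r powr (\<gamma> / q) < D (X i * r)} s *
        ennreal (s powr (\<gamma> - 1))) \<longlonglongrightarrow>
      indicator {r. 0 < r \<and> 1 * r powr (\<gamma> / q) < a} s * ennreal (s powr (\<gamma> - 1))"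
      by (intro tendsto_eventually) (auto elim!: eventually_mono simp: indicator_def)
  qed
qed

text \<open>This links the finite product sigma-algebra with the Borel sets of the full function
  space: the coordinates from \<open>n\<close> on are constantly \<open>undefined\<close>, so the
  inclusion is measurable.\<close>

lemma borel_measurable_lebesgue_Rn_continuous:
  assumes "continuous_on (Rn n) (g :: vec \<Rightarrow> real)"
  shows "g \<in> borel_measurable (lebesgue_Rn n)"
proof -
  have "(\<lambda>h. h) \<in> borel_measurable (lebesgue_Rn n)"
  proof (rule measurable_coordinatewise_then_product)
    fix i
    show "(\<lambda>h. h i) \<in> borel_measurable (lebesgue_Rn n)"
    proof (cases "i < n")
      case True
      then show ?thesis
        using measurable_component_singleton[of i "{..<n}" "\<lambda>_. lborel"] by simp
    next
      case False
      have "h i = undefined" if "h \<in> space (lebesgue_Rn n)" for h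
        using that False by (intro PiE_arb[of h "{..<n}" "\<lambda>_. UNIV"]) (simp_all add: Rn_def)
      then have "(\<lambda>h. h i) \<in> borel_measurable (lebesgue_Rn n) \<longleftrightarrow>
          (\<lambda>_. undefined :: real) \<in> borel_measurable (lebesgue_Rn n)"
        by (rule measurable_cong)
      then show ?thesis by simp
    qed
  qed
  then have "(\<lambda>h. h) \<in> lebesgue_Rn n \<rightarrow>\<^sub>M restrict_space borel (Rn n)"
    by (intro measurable_restrict_space2) auto
  from measurable_compose[OF this borel_measurable_continuous_on_restrict[OF assms]]
  show ?thesis .
qed

subsection \<open>The weak-type functional\<close>

lemma measurable_add_scaled:
  assumes "h \<in> M \<rightarrow>\<^sub>M lebesgue_Rn n"
  shows "(\<lambda>w. add_scaled n x c (h w)) \<in> M \<rightarrow>\<^sub>M lebesgue_Rn n"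
proof -
  have [measurable]: "(\<lambda>w. h w i) \<in> borel_measurable M" if "i \<in> {..<n}" for i
    using measurable_compose[OF assms measurable_component_singleton[OF that]] by simp
  show ?thesis
    unfolding add_scaled_def by measurable
qed

lemma measurable_fdiff:
  assumes "Ck n k f" "h \<in> M \<rightarrow>\<^sub>M lebesgue_Rn n"
  shows "(\<lambda>w. fdiff n k (h w) f x) \<in> borel_measurable M"
proof -
  have "f \<in> borel_measurable (lebesgue_Rn n)"
    using Ck_continuous[OF assms(1), of "[]"] by (intro borel_measurable_lebesgue_Rn_continuous) simp
  then have [measurable]: "(\<lambda>w. f (add_scaled n x c (h w))) \<in> borel_measurable M" for c
    by (rule measurable_compose[OF measurable_add_scaled[OF assms(2)]])
  show ?thesis
    unfolding fdiff_def by measurable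
qed

lemma measurable_Ddir: "(\<lambda>\<theta>. Ddir n k \<theta> f x) \<in> borel_measurable (lebesgue_Rn n)"
proof -
  have "(\<lambda>\<theta>. \<theta> (is ! j)) \<in> borel_measurable (lebesgue_Rn n)"
    if "is \<in> index_lists n k" "j \<in> {..<k}" for "is" j
  proof -
    have "is ! j \<in> set is" using that by (intro nth_mem) simp
    then have "is ! j \<in> {..<n}" using that by blast
    then show ?thesis using measurable_component_singleton[of "is ! j" "{..<n}" "\<lambda>_. lborel"] by simp
  qed
  then show ?thesis
    unfolding Ddir_altdef
    by (intro borel_measurable_sum borel_measurable_times borel_measurable_prod borel_measurable_const)
qed

lemma fdiff_scale:
  "fdiff n k (scale n r \<theta>) f x = line_diff k r (\<lambda>u. f (add_scaled n x u \<theta>)) 0"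
proof -
  have "add_scaled n x c (scale n r \<theta>) = add_scaled n x (c * r) \<theta>" for c
    by (auto simp: add_scaled_def scale_def)
  then show ?thesis by (simp add: fdiff_def line_diff_def)
qed

definition ray_quot :: "nat \<Rightarrow> nat \<Rightarrow> (vec \<Rightarrow> real) \<Rightarrow> vec \<Rightarrow> vec \<Rightarrow> real \<Rightarrow> real" where
  "ray_quot n k f x \<theta> r = \<bar>fdiff n k (scale n r \<theta>) f x\<bar> / r ^ k"

lemma measurable_ray_quot:
  assumes "Ck n k f" "\<theta> \<in> Rn n"
  shows "ray_quot n k f x \<theta> \<in> borel_measurable borel"
proof -
  have "(\<lambda>r. scale n r \<theta>) \<in> borel \<rightarrow>\<^sub>M lebesgue_Rn n"
    using assms by (intro measurable_scale measurable_const) auto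
  from measurable_fdiff[OF assms(1) this] show ?thesis
    unfolding ray_quot_def [abs_def] by measurable
qed

text \<open>The factor \<open>c\<close> covers the rescaled quotients and, with c = 1, the original
  ones. Joint measurability in direction and radius is what the inner integral requires.\<close>

lemma measurable_ray_int_ray_quot:
  assumes "Ck n k f"
  shows "(\<lambda>\<theta>. ray_int \<gamma> q lam (\<lambda>s. ray_quot n k f x \<theta> (c * s))) \<in> borel_measurable (lebesgue_Rn n)"
proof -
  have "(\<lambda>(\<theta>, s). scale n (c * s) \<theta>) \<in> lebesgue_Rn n \<Otimes>\<^sub>M lborel \<rightarrow>\<^sub>M lebesgue_Rn n"
    by measurable
  from measurable_fdiff[OF assms this]
  have [measurable]: "(\<lambda>(\<theta>, s). fdiff n k (scale n (c * s) \<theta>) f x) \<in> borel_measurable (lebesgue_Rn n \<Otimes>\<^sub>M lborel)"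
    by (simp add: case_prod_unfold)
  show ?thesis
    unfolding ray_int_def ray_quot_def indicator_def mem_Collect_eq by measurable
qed

lemma ray_quot_eq_Ddir:
  assumes "k \<ge> 1" "Ck n k f" "r > 0" "x \<in> Rn n"
  shows "\<exists>\<xi>. 0 \<le> \<xi> \<and> \<xi> \<le> real k * r \<and>
    ray_quot n k f x \<theta> r = \<bar>Ddir n k \<theta> f (add_scaled n x \<xi> \<theta>)\<bar>"
proof -
  let ?G = "\<lambda>j u. Ddir n j \<theta> f (add_scaled n x u \<theta>)"
  obtain \<xi> where "0 \<le> \<xi>" "\<xi> \<le> 0 + real k * r" "line_diff k r (?G 0) 0 = r ^ k * ?G k \<xi>"
    using line_diff_eq_deriv[of r k ?G 0] Ddir_has_real_derivative assms by blast
  then show ?thesis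
    using assms by (intro exI[of _ \<xi>]) (simp add: ray_quot_def fdiff_scale abs_mult)
qed

lemma ray_quot_tendsto:
  assumes "k \<ge> 1" "Ck n k f" "x \<in> Rn n"
  shows "(ray_quot n k f x \<theta> \<longlongrightarrow> \<bar>Ddir n k \<theta> f x\<bar>) (at_right 0)"
proof -
  let ?g = "\<lambda>u. \<bar>Ddir n k \<theta> f (add_scaled n x u \<theta>)\<bar>"
  \<comment> \<open>A mean value point is chosen for every \<open>r\<close>; squeezed between 0 and
    k r, it tends to 0.\<close>
  have "\<exists>\<xi>. \<forall>r. r > 0 \<longrightarrow> 0 \<le> \<xi> r \<and> \<xi> r \<le> real k * r \<and> ray_quot n k f x \<theta> r = ?g (\<xi> r)"
    using ray_quot_eq_Ddir[OF assms(1,2) _ assms(3)] by (intro choice allI) blast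
  then obtain \<xi> where \<xi>: "\<And>r. r > 0 \<Longrightarrow> 0 \<le> \<xi> r" "\<And>r. r > 0 \<Longrightarrow> \<xi> r \<le> real k * r"
    "\<And>r. r > 0 \<Longrightarrow> ray_quot n k f x \<theta> r = ?g (\<xi> r)"
    by blast
  have "((\<lambda>r. real k * r) \<longlongrightarrow> real k * 0) (at_right 0)"
    by (intro tendsto_intros)
  then have lim: "(\<xi> \<longlongrightarrow> 0) (at_right 0)"
    using \<xi> by (intro tendsto_sandwich[of "\<lambda>_. 0" \<xi> "at_right 0" "\<lambda>r. real k * r" 0])
      (auto simp: eventually_at_filter)
  have "isCont ?g 0"
    using continuous_on_Ddir_line[OF assms(2), of \<theta> x]
    by (intro continuous_intros) (simp add: continuous_on_eq_continuous_at)
  from isCont_tendsto_compose[OF this lim] assms(3)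
  have "((\<lambda>r. ?g (\<xi> r)) \<longlongrightarrow> \<bar>Ddir n k \<theta> f x\<bar>) (at_right 0)"
    by simp
  then show ?thesis
    by (rule Lim_transform_eventually) (auto simp: eventually_at_filter \<xi>(3))
qed

text \<open>The integral over \<open>{0..real k * r}\<close> is k r times an average that the
  maximal function bounds. With r^(k-1) this gives k r^k, and dividing by r^k leaves the constant
  k.\<close>

lemma ray_quot_le_Mdir:
  assumes "k \<ge> 1" "Ck n k f" "r > 0"
  shows "ennreal (ray_quot n k f x \<theta> r) \<le> ennreal (real k) * Mdir n \<theta> (\<lambda>y. \<bar>Ddir n k \<theta> f y\<bar>) x"
proof -
  let ?G = "\<lambda>j u. Ddir n j \<theta> f (add_scaled n x u \<theta>)"
  let ?M = "Mdir n \<theta> (\<lambda>y. \<bar>Ddir n k \<theta> f y\<bar>) x"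
  let ?I = "\<integral>\<^sup>+s\<in>{0..real k * r}. ennreal \<bar>?G k s\<bar> \<partial>lborel"
  have kr: "real k * r > 0" using assms by simp
  have "ennreal (1 / (real k * r)) * ?I \<le> ?M"
    unfolding Mdir_def using kr by (intro SUP_upper2[of "real k * r"]) auto
  then have "ennreal (real k * r) * (ennreal (1 / (real k * r)) * ?I) \<le> ennreal (real k * r) * ?M"
    by (rule mult_left_mono) simp
  moreover have "ennreal (real k * r) * (ennreal (1 / (real k * r)) * ?I) = ?I"
    using kr by (simp flip: mult.assoc ennreal_mult)
  ultimately have I: "?I \<le> ennreal (real k * r) * ?M" by simp
  have "ennreal \<bar>line_diff k r (?G 0) 0\<bar> \<le> ennreal (r ^ (k - 1)) * ?I"
    using assms Ddir_has_real_derivative continuous_on_Ddir_line[OF assms(2)]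
    by (intro line_diff_le_nn_integral) auto
  also have "\<dots> \<le> ennreal (r ^ (k - 1)) * (ennreal (real k * r) * ?M)"
    by (intro mult_left_mono I) simp
  also have "\<dots> = ennreal (r ^ (k - 1) * (real k * r)) * ?M"
    using kr assms by (simp add: ennreal_mult mult.assoc)
  also have "r ^ (k - 1) * (real k * r) = r ^ k * real k"
    using assms by (cases k) auto
  finally have "ennreal (1 / r ^ k) * ennreal \<bar>line_diff k r (?G 0) 0\<bar> \<le>
      ennreal (1 / r ^ k) * (ennreal (r ^ k * real k) * ?M)"
    by (rule mult_left_mono) simp
  also have "\<dots> = ennreal (1 / r ^ k * (r ^ k * real k)) * ?M"
    using assms by (subst ennreal_mult) (simp_all add: mult.assoc)
  also have "1 / r ^ k * (r ^ k * real k) = real k"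
    using assms by simp
  also have "ennreal (1 / r ^ k) * ennreal \<bar>line_diff k r (?G 0) 0\<bar> = ennreal (ray_quot n k f x \<theta> r)"
    using assms by (simp add: ray_quot_def fdiff_scale flip: ennreal_mult)
  finally show ?thesis .
qed

lemma sets_E_set:
  assumes "Ck n k f"
  shows "E_set n k f lam q \<gamma> x \<in> sets (lebesgue_Rn n)"
proof -
  have [measurable]: "(\<lambda>h. fdiff n k h f x) \<in> borel_measurable (lebesgue_Rn n)"
    by (rule measurable_fdiff[OF assms]) simp
  have "{h \<in> space (lebesgue_Rn n). \<bar>fdiff n k h f x\<bar> > lam * vnorm n h powr (real k + \<gamma> / q)}
      \<in> sets (lebesgue_Rn n)"
    by measurable
  then show ?thesis by (simp add: E_set_def)
qed

lemma weak_functional_polar: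
  assumes n: "n \<ge> 1" and f: "Ck n k f"
  shows "weak_functional n k f lam q \<gamma> x =
    ennreal lam * epowr (\<integral>\<^sup>+\<theta>. ray_int \<gamma> q lam (ray_quot n k f x \<theta>) \<partial>sphere_measure n) (1 / q)"
proof -
  let ?E = "E_set n k f lam q \<gamma> x"
  have [measurable]: "?E \<in> sets (lebesgue_Rn n)" by (rule sets_E_set[OF f])
  have "(\<integral>\<^sup>+h\<in>?E. ennreal (vnorm n h powr (\<gamma> - real n)) \<partial>lebesgue_Rn n) =
    (\<integral>\<^sup>+\<theta>. (\<integral>\<^sup>+r. indicator {0<..} r * ennreal (r powr (real n - 1)) *
      (ennreal (vnorm n (scale n r \<theta>) powr (\<gamma> - real n)) * indicator ?E (scale n r \<theta>)) \<partial>lborel)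
      \<partial>sphere_measure n)"
    by (intro nn_integral_lebesgue_Rn_polar n) measurable
  also have "\<dots> = (\<integral>\<^sup>+\<theta>. ray_int \<gamma> q lam (ray_quot n k f x \<theta>) \<partial>sphere_measure n)"
  proof (rule nn_integral_cong_AE, rule eventually_mono[OF AE_sphere_measure])
    fix \<theta> assume \<theta>: "\<theta> \<in> Rn n \<and> vnorm n \<theta> = 1"
    show "(\<integral>\<^sup>+r. indicator {0<..} r * ennreal (r powr (real n - 1)) *
        (ennreal (vnorm n (scale n r \<theta>) powr (\<gamma> - real n)) * indicator ?E (scale n r \<theta>)) \<partial>lborel) =
      ray_int \<gamma> q lam (ray_quot n k f x \<theta>)"
      unfolding ray_int_def
    proof (rule nn_integral_cong)
      fix r :: real
      \<comment> \<open>On the unit sphere the norm of the scaled vector is r, and dividing the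
        defining inequality by r^k leaves the power \<gamma>/q.\<close>
      have iff: "scale n r \<theta> \<in> ?E \<longleftrightarrow> lam * r powr (\<gamma> / q) < ray_quot n k f x \<theta> r" if "r > 0"
        using that \<theta> by (simp add: E_set_def vnorm_scale ray_quot_def powr_add powr_realpow field_simps)
      have "r powr (real n - 1) * r powr (\<gamma> - real n) = r powr (\<gamma> - 1)"
        by (simp flip: powr_add)
      then have pw: "ennreal (r powr (real n - 1)) * ennreal (r powr (\<gamma> - real n)) = ennreal (r powr (\<gamma> - 1))"
        by (simp flip: ennreal_mult)
      show "indicator {0<..} r * ennreal (r powr (real n - 1)) *
          (ennreal (vnorm n (scale n r \<theta>) powr (\<gamma> - real n)) * indicator ?E (scale n r \<theta>)) =
        indicator {r. 0 < r \<and> lam * r powr (\<gamma> / q) < ray_quot n k f x \<theta> r} r * ennreal (r powr (\<gamma> - 1))"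
        using \<theta> iff pw by (cases "r > 0") (auto simp: vnorm_scale indicator_def)
    qed
  qed
  finally show ?thesis by (simp add: weak_functional_def)
qed

text \<open>The prefactor \<epsilon>^(-\<gamma>/q) enters the power 1/q as \<epsilon>^(-\<gamma>),
  exactly the factor absorbed by \<open>ray_int_rescale\<close>. The level becomes 1 and \<epsilon>
  survives only in the quotient.\<close>

lemma weak_functional_rescale:
  assumes n: "n \<ge> 1" and f: "Ck n k f" and \<epsilon>: "\<epsilon> > 0"
  shows "weak_functional n k f (\<epsilon> powr (-\<gamma> / q)) q \<gamma> x =
    epowr (\<integral>\<^sup>+\<theta>. ray_int \<gamma> q 1 (\<lambda>s. ray_quot n k f x \<theta> (\<epsilon> * s)) \<partial>sphere_measure n) (1 / q)"
proof -
  let ?l = "\<epsilon> powr (-\<gamma> / q)"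
  have [measurable]: "(\<lambda>\<theta>. ray_int \<gamma> q ?l (ray_quot n k f x \<theta>)) \<in> borel_measurable (sphere_measure n)"
    using measurable_ray_int_ray_quot[OF f, of \<gamma> q ?l x 1]
    by (simp add: measurable_cong_sets[OF sets_sphere_measure refl])
  have "weak_functional n k f ?l q \<gamma> x =
      epowr (ennreal (\<epsilon> powr (-\<gamma>)) * (\<integral>\<^sup>+\<theta>. ray_int \<gamma> q ?l (ray_quot n k f x \<theta>) \<partial>sphere_measure n)) (1 / q)"
    using \<epsilon> by (simp add: weak_functional_polar[OF n f] epowr_mult powr_powr)
  also have "ennreal (\<epsilon> powr (-\<gamma>)) * (\<integral>\<^sup>+\<theta>. ray_int \<gamma> q ?l (ray_quot n k f x \<theta>) \<partial>sphere_measure n) =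
      (\<integral>\<^sup>+\<theta>. ennreal (\<epsilon> powr (-\<gamma>)) * ray_int \<gamma> q ?l (ray_quot n k f x \<theta>) \<partial>sphere_measure n)"
    by (rule nn_integral_cmult[symmetric]) measurable
  also have "\<dots> = (\<integral>\<^sup>+\<theta>. ray_int \<gamma> q 1 (\<lambda>s. ray_quot n k f x \<theta> (\<epsilon> * s)) \<partial>sphere_measure n)"
    by (rule nn_integral_cong_AE, rule eventually_mono[OF AE_sphere_measure],
        rule ray_int_rescale[OF \<epsilon> measurable_ray_quot[OF f]]) simp
  finally show ?thesis .
qed

text \<open>The claimed limit takes the shape of the rescaled functional, with the quotient replaced
  by its limit at radius 0.\<close>

lemma Anorm_altdef:
  assumes "\<gamma> \<noteq> 0" "q > 0"
  shows "ennreal (\<bar>\<gamma>\<bar> powr (- 1 / q)) * Anorm n k q (Dform n k f x) =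
    epowr (\<integral>\<^sup>+\<theta>. ray_int \<gamma> q 1 (\<lambda>_. \<bar>Ddir n k \<theta> f x\<bar>) \<partial>sphere_measure n) (1 / q)"
proof -
  have [measurable]: "(\<lambda>\<theta>. Ddir n k \<theta> f x) \<in> borel_measurable (sphere_measure n)"
    using measurable_Ddir by (simp add: measurable_cong_sets[OF sets_sphere_measure refl])
  have "ray_int \<gamma> q 1 (\<lambda>_. \<bar>Ddir n k \<theta> f x\<bar>) =
      ennreal (1 / \<bar>\<gamma>\<bar>) * ennreal (\<bar>Ddir n k \<theta> f x\<bar> powr q)" for \<theta>
    using assms by (simp add: ray_int_const flip: ennreal_mult)
  then have "(\<integral>\<^sup>+\<theta>. ray_int \<gamma> q 1 (\<lambda>_. \<bar>Ddir n k \<theta> f x\<bar>) \<partial>sphere_measure n) =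
      ennreal (1 / \<bar>\<gamma>\<bar>) * (\<integral>\<^sup>+\<theta>. ennreal (\<bar>Ddir n k \<theta> f x\<bar> powr q) \<partial>sphere_measure n)"
    by (simp add: nn_integral_cmult)
  moreover have "(1 / \<bar>\<gamma>\<bar>) powr (1 / q) = \<bar>\<gamma>\<bar> powr (- 1 / q)"
    by (simp add: powr_divide powr_minus_divide)
  ultimately show ?thesis
    using assms by (simp add: epowr_mult Anorm_def Ddir_def)
qed

text \<open>A second dominated convergence, over directions, uses \<open>ray_int_tendsto\<close>
  pointwise; passing to sequences makes the theorem applicable.\<close>

lemma weak_functional_tendsto:
  assumes n: "n \<ge> 1" and k: "k \<ge> 1" and f: "Ck_compact n k f"
    and \<gamma>: "\<gamma> \<noteq> 0" and q: "q > 0" and x: "x \<in> Rn n"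
  shows "((\<lambda>\<epsilon>. weak_functional n k f (\<epsilon> powr (-\<gamma> / q)) q \<gamma> x) \<longlongrightarrow>
    ennreal (\<bar>\<gamma>\<bar> powr (- 1 / q)) * Anorm n k q (Dform n k f x)) (at_right 0)"
  unfolding tendsto_at_iff_sequentially comp_def
proof (intro allI impI)
  fix X :: "nat \<Rightarrow> real" assume "\<forall>i. X i \<in> {0<..} - {0}" and X0: "X \<longlonglongrightarrow> 0"
  then have X: "X i > 0" for i by simp
  let ?S = "sphere_measure n"
  have Ck: "Ck n k f" using f by (simp add: Ck_compact_def)
  obtain K where K: "K > 0"
    "\<And>y \<theta>. y \<in> Rn n \<Longrightarrow> vnorm n \<theta> \<le> 1 \<Longrightarrow> \<bar>Ddir n k \<theta> f y\<bar> \<le> K"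
    using Ddir_bounded[OF f] by blast
  have quot_le: "ray_quot n k f x \<theta> r \<le> K" if "vnorm n \<theta> = 1" "r > 0" for \<theta> r
    using ray_quot_eq_Ddir[OF k Ck \<open>r > 0\<close> x, of \<theta>] K(2)[of _ \<theta>] that by auto
  have Ddir_le: "\<bar>Ddir n k \<theta> f x\<bar> \<le> K" if "vnorm n \<theta> = 1" for \<theta>
    using K(2)[OF x, of \<theta>] that by simp
  \<comment> \<open>One constant \<open>K\<close> bounds all unit directions, so the majorant does
    not depend on \<theta> and is integrable because the sphere has finite mass.\<close>
  let ?w = "ray_int \<gamma> q 1 (\<lambda>_. K)"
  have w: "?w < \<infinity>"
    using K \<gamma> q by (simp add: ray_int_const)
  have wS: "(\<integral>\<^sup>+\<theta>. ?w \<partial>?S) < \<infinity>"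
    using w emeasure_sphere_measure_finite[of n] by (simp add: ennreal_mult_less_top)
  have m: "(\<lambda>\<theta>. ray_int \<gamma> q 1 (\<lambda>_. \<bar>Ddir n k \<theta> f x\<bar>)) \<in> borel_measurable ?S"
  proof -
    have [measurable]: "(\<lambda>\<theta>. Ddir n k \<theta> f x) \<in> borel_measurable ?S"
      using measurable_Ddir by (simp add: measurable_cong_sets[OF sets_sphere_measure refl])
    show ?thesis using \<gamma> q by (simp add: ray_int_const)
  qed
  have "(\<lambda>i. \<integral>\<^sup>+\<theta>. ray_int \<gamma> q 1 (\<lambda>s. ray_quot n k f x \<theta> (X i * s)) \<partial>?S) \<longlonglongrightarrow>
      (\<integral>\<^sup>+\<theta>. ray_int \<gamma> q 1 (\<lambda>_. \<bar>Ddir n k \<theta> f x\<bar>) \<partial>?S)"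
  proof (rule nn_integral_dominated_convergence[OF _ m _ _ wS])
    show "(\<lambda>\<theta>. ray_int \<gamma> q 1 (\<lambda>s. ray_quot n k f x \<theta> (X i * s))) \<in> borel_measurable ?S" for i
      using measurable_ray_int_ray_quot[OF Ck, of \<gamma> q 1 x "X i"]
      by (simp add: measurable_cong_sets[OF sets_sphere_measure refl])
    show "AE \<theta> in ?S. ray_int \<gamma> q 1 (\<lambda>s. ray_quot n k f x \<theta> (X i * s)) \<le> ?w" for i
      using X[of i]
      by (intro eventually_mono[OF AE_sphere_measure] ray_int_mono quot_le) auto
    show "AE \<theta> in ?S. (\<lambda>i. ray_int \<gamma> q 1 (\<lambda>s. ray_quot n k f x \<theta> (X i * s))) \<longlonglongrightarrow>
        ray_int \<gamma> q 1 (\<lambda>_. \<bar>Ddir n k \<theta> f x\<bar>)"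
    proof (rule eventually_mono[OF AE_sphere_measure])
      fix \<theta> assume \<theta>: "\<theta> \<in> Rn n \<and> vnorm n \<theta> = 1"
      show "(\<lambda>i. ray_int \<gamma> q 1 (\<lambda>s. ray_quot n k f x \<theta> (X i * s))) \<longlonglongrightarrow>
          ray_int \<gamma> q 1 (\<lambda>_. \<bar>Ddir n k \<theta> f x\<bar>)"
        using \<theta> K quot_le
        by (intro ray_int_tendsto[OF \<gamma> q measurable_ray_quot[OF Ck], where K = K]
            ray_quot_tendsto k Ck x X X0) auto
    qed
  qed simp
  moreover have "(\<integral>\<^sup>+\<theta>. ray_int \<gamma> q 1 (\<lambda>_. \<bar>Ddir n k \<theta> f x\<bar>) \<partial>?S) \<noteq> \<infinity>"
  proof -
    have "(\<integral>\<^sup>+\<theta>. ray_int \<gamma> q 1 (\<lambda>_. \<bar>Ddir n k \<theta> f x\<bar>) \<partial>?S) \<le> (\<integral>\<^sup>+\<theta>. ?w \<partial>?S)"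
      by (intro nn_integral_mono_AE eventually_mono[OF AE_sphere_measure] ray_int_mono Ddir_le) auto
    with wS show ?thesis by (auto simp: top_unique)
  qed
  ultimately show "(\<lambda>i. weak_functional n k f (X i powr (-\<gamma> / q)) q \<gamma> x) \<longlonglongrightarrow>
      ennreal (\<bar>\<gamma>\<bar> powr (- 1 / q)) * Anorm n k q (Dform n k f x)"
    unfolding Anorm_altdef[OF \<gamma> q] weak_functional_rescale[OF n Ck X]
    using q by (intro tendsto_epowr) auto
qed

text \<open>On each ray the quotient is replaced by the constant k times the maximal function, for
  which the ray integral is explicit.\<close>

lemma weak_functional_le:
  assumes n: "n \<ge> 1" and k: "k \<ge> 1" and f: "Ck n k f"
    and \<gamma>: "\<gamma> \<noteq> 0" and q: "q > 0" and lam: "lam > 0"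
  shows "weak_functional n k f lam q \<gamma> x \<le> ennreal (real k * \<bar>\<gamma>\<bar> powr (- 1 / q)) *
    epowr (\<integral>\<^sup>+\<theta>. epowr (Mdir n \<theta> (\<lambda>y. \<bar>Ddir n k \<theta> f y\<bar>) x) q \<partial>sphere_measure n) (1 / q)"
proof -
  let ?S = "sphere_measure n"
  let ?M = "\<lambda>\<theta>. Mdir n \<theta> (\<lambda>y. \<bar>Ddir n k \<theta> f y\<bar>) x"
  let ?R = "\<lambda>\<theta>. ray_int \<gamma> q lam (ray_quot n k f x \<theta>)"
  \<comment> \<open>This factor inverts \<open>ray_int_const\<close>: for the constant k m the
    product is exactly m^q.\<close>
  define c where "c = \<bar>\<gamma>\<bar> * (lam / real k) powr q"
  have c: "c > 0" using \<gamma> lam k by (simp add: c_def)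
  have [measurable]: "?R \<in> borel_measurable ?S"
    using measurable_ray_int_ray_quot[OF f, of \<gamma> q lam x 1]
    by (simp add: measurable_cong_sets[OF sets_sphere_measure refl])
  have pointwise: "ennreal c * ?R \<theta> \<le> epowr (?M \<theta>) q" for \<theta>
  proof (cases "?M \<theta>")
    case (real m)
    have "ray_quot n k f x \<theta> r \<le> real k * m" if "r > 0" for r
      using ray_quot_le_Mdir[OF k f that, of x \<theta>] real
      by (simp add: ennreal_le_iff flip: ennreal_mult)
    then have "?R \<theta> \<le> ray_int \<gamma> q lam (\<lambda>_. real k * m)"
      by (rule ray_int_mono)
    also have "\<dots> = ennreal ((real k * m / lam) powr q / \<bar>\<gamma>\<bar>)"
      using real \<gamma> q lam by (intro ray_int_const) auto
    finally have "ennreal c * ?R \<theta> \<le> ennreal c * ennreal ((real k * m / lam) powr q / \<bar>\<gamma>\<bar>)"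
      by (rule mult_left_mono) simp
    also have "\<dots> = ennreal (c * ((real k * m / lam) powr q / \<bar>\<gamma>\<bar>))"
      using c by (intro ennreal_mult[symmetric]) simp_all
    also have "c * ((real k * m / lam) powr q / \<bar>\<gamma>\<bar>) = ((lam / real k) * (real k * m / lam)) powr q"
      using \<gamma> lam k real by (simp only: c_def powr_mult[of "lam / real k"]) simp
    also have "(lam / real k) * (real k * m / lam) = m"
      using lam k by simp
    finally show ?thesis
      using real by (simp add: epowr_def)
  \<comment> \<open>If the maximal function is infinite, the right-hand side is infinite.\<close>
  qed (simp add: epowr_def)
  have "ennreal (c powr (1 / q)) * epowr (\<integral>\<^sup>+\<theta>. ?R \<theta> \<partial>?S) (1 / q) =
      epowr (\<integral>\<^sup>+\<theta>. ennreal c * ?R \<theta> \<partial>?S) (1 / q)"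
    using c by (simp add: epowr_mult nn_integral_cmult)
  also have "\<dots> \<le> epowr (\<integral>\<^sup>+\<theta>. epowr (?M \<theta>) q \<partial>?S) (1 / q)"
    using q by (intro epowr_mono nn_integral_mono pointwise) simp
  finally have "ennreal (real k * \<bar>\<gamma>\<bar> powr (- 1 / q)) *
      (ennreal (c powr (1 / q)) * epowr (\<integral>\<^sup>+\<theta>. ?R \<theta> \<partial>?S) (1 / q)) \<le>
      ennreal (real k * \<bar>\<gamma>\<bar> powr (- 1 / q)) * epowr (\<integral>\<^sup>+\<theta>. epowr (?M \<theta>) q \<partial>?S) (1 / q)"
    by (rule mult_left_mono) simp
  moreover have "ennreal (real k * \<bar>\<gamma>\<bar> powr (- 1 / q)) * ennreal (c powr (1 / q)) = ennreal lam"
  proof -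
    have "c powr (1 / q) = \<bar>\<gamma>\<bar> powr (1 / q) * (lam / real k)"
      using lam k q by (simp add: c_def powr_mult powr_powr)
    moreover have "\<bar>\<gamma>\<bar> powr (- 1 / q) * \<bar>\<gamma>\<bar> powr (1 / q) = 1"
      using \<gamma> by (simp flip: powr_add)
    ultimately have "real k * \<bar>\<gamma>\<bar> powr (- 1 / q) * c powr (1 / q) = lam"
      using k by (simp add: mult.assoc mult.left_commute[of "\<bar>\<gamma>\<bar> powr (- 1 / q)"])
    then show ?thesis
      by (simp flip: ennreal_mult)
  qed
  ultimately show ?thesis
    unfolding weak_functional_polar[OF n f] by (simp only: mult.assoc[symmetric])
qed

section \<open>From limits in \<epsilon> back to limits in \<lambda>\<close>

lemma powr_inverse_exponent:
  fixes lam p :: real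
  assumes "p \<noteq> 0" "lam > 0"
  shows "(lam powr (1 / p)) powr p = lam"
  using assms by (simp add: powr_powr)

text \<open>Solving \<lambda> = \<epsilon>^(-\<gamma>/q) for \<epsilon> gives the power in the
  hypothesis \<open>lim\<close>; any filter that drives it to 0 through positive \<lambda> inherits
  the limit.\<close>

lemma weak_functional_tendsto_filter:
  assumes "n \<ge> 1" "k \<ge> 1" "Ck_compact n k f" "\<gamma> \<noteq> 0" "q > 0" "x \<in> Rn n"
    and lim: "((\<lambda>lam. lam powr (1 / (-\<gamma> / q))) \<longlongrightarrow> 0) F" and pos: "\<forall>\<^sub>F lam in F. lam > 0"
  shows "((\<lambda>lam. weak_functional n k f lam q \<gamma> x) \<longlongrightarrow>
    ennreal (\<bar>\<gamma>\<bar> powr (- 1 / q)) * Anorm n k q (Dform n k f x)) F"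
proof -
  have "filterlim (\<lambda>lam. lam powr (1 / (-\<gamma> / q))) (at_right 0) F"
    using lim pos by (intro tendsto_imp_filterlim_at_right) (auto elim!: eventually_mono)
  from filterlim_compose[OF weak_functional_tendsto[OF assms(1-6)] this]
  show ?thesis
  proof (rule Lim_transform_eventually)
    have "-\<gamma> / q \<noteq> 0" using assms by simp
    then show "\<forall>\<^sub>F lam in F. weak_functional n k f ((lam powr (1 / (-\<gamma> / q))) powr (-\<gamma> / q)) q \<gamma> x =
        weak_functional n k f lam q \<gamma> x"
      by (intro eventually_mono[OF pos]) (subst powr_inverse_exponent; simp)
  qed
qed

lemma weak_functional_tendsto_at_top:
  assumes "n \<ge> 1" "k \<ge> 1" "Ck_compact n k f" "\<gamma> > 0" "q > 0" "x \<in> Rn n"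
  shows "((\<lambda>lam. weak_functional n k f lam q \<gamma> x) \<longlongrightarrow>
    ennreal (\<gamma> powr (- 1 / q)) * Anorm n k q (Dform n k f x)) at_top"
proof -
  \<comment> \<open>For \<gamma> > 0 the exponent is negative, so \<epsilon> tends to 0 as \<lambda>
    grows.\<close>
  have "((\<lambda>lam. lam powr (1 / (-\<gamma> / q))) \<longlongrightarrow> 0) at_top"
    using assms by (intro tendsto_neg_powr filterlim_ident) simp
  from weak_functional_tendsto_filter[OF assms(1-3) _ assms(5,6) this] assms show ?thesis
    by (simp add: eventually_gt_at_top)
qed

lemma weak_functional_tendsto_at_right_0:
  assumes "n \<ge> 1" "k \<ge> 1" "Ck_compact n k f" "\<gamma> < 0" "q > 0" "x \<in> Rn n"
  shows "((\<lambda>lam. weak_functional n k f lam q \<gamma> x) \<longlongrightarrow>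
    ennreal ((- \<gamma>) powr (- 1 / q)) * Anorm n k q (Dform n k f x)) (at_right 0)"
proof -
  have pos: "\<forall>\<^sub>F lam in at_right 0. lam > (0::real)"
    by (simp add: eventually_at_filter)
  \<comment> \<open>For \<gamma> < 0 the exponent is positive, so \<epsilon> tends to 0 together
    with \<lambda>.\<close>
  have "0 < 1 / (-\<gamma> / q)"
    using assms by (intro divide_pos_pos) simp_all
  moreover from this have "((\<lambda>lam. lam powr (1 / (-\<gamma> / q))) \<longlongrightarrow> 0 powr (1 / (-\<gamma> / q))) (at_right 0)"
    by (intro tendsto_powr' tendsto_const tendsto_ident_at) (auto simp: eventually_at_filter)
  ultimately have "((\<lambda>lam. lam powr (1 / (-\<gamma> / q))) \<longlongrightarrow> 0) (at_right 0)"
    by simp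
  from weak_functional_tendsto_filter[OF assms(1-3) _ assms(5,6) this pos] assms show ?thesis
    by simp
qed

theorem theorem3p15:
  fixes k :: nat
  assumes "k \<ge> 1"
  shows
    "(\<forall>(n::nat) (f :: vec \<Rightarrow> real) (\<gamma>::real) (q::real) (x::vec).
        n \<ge> 1 \<and> Ck_compact n k f \<and> \<gamma> \<noteq> 0 \<and> 0 < q \<and> x \<in> Rn n \<longrightarrow>
          (\<gamma> > 0 \<longrightarrow>
             ((\<lambda>lam. weak_functional n k f lam q \<gamma> x) \<longlongrightarrow>
                ennreal (\<gamma> powr (- 1 / q)) * Anorm n k q (Dform n k f x)) at_top) \<and>
          (\<gamma> < 0 \<longrightarrow>
             ((\<lambda>lam. weak_functional n k f lam q \<gamma> x) \<longlongrightarrow>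
                ennreal ((- \<gamma>) powr (- 1 / q)) * Anorm n k q (Dform n k f x)) (at_right 0))) \<and>
     (\<exists>C::real. C \<ge> 0 \<and>
        (\<forall>(n::nat) (f :: vec \<Rightarrow> real) (\<gamma>::real) (q::real) (x::vec).
           n \<ge> 1 \<and> Ck_compact n k f \<and> \<gamma> \<noteq> 0 \<and> 0 < q \<and> x \<in> Rn n \<longrightarrow>
             (SUP lam\<in>{0<..}. weak_functional n k f lam q \<gamma> x)
               \<le> ennreal (C * \<bar>\<gamma>\<bar> powr (- 1 / q)) *
                  epowr (\<integral>\<^sup>+\<theta>. epowr (Mdir n \<theta> (\<lambda>y. \<bar>Ddir n k \<theta> f y\<bar>) x) q \<partial>sphere_measure n) (1 / q)))"
proof (intro conjI allI impI exI[of _ "real k"]; (elim conjE)?)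
  fix n f and \<gamma> q :: real and x
  assume "n \<ge> 1" "Ck_compact n k f" "\<gamma> \<noteq> 0" "0 < q" "x \<in> Rn n"
  then show "(SUP lam\<in>{0<..}. weak_functional n k f lam q \<gamma> x)
      \<le> ennreal (real k * \<bar>\<gamma>\<bar> powr (- 1 / q)) *
        epowr (\<integral>\<^sup>+\<theta>. epowr (Mdir n \<theta> (\<lambda>y. \<bar>Ddir n k \<theta> f y\<bar>) x) q \<partial>sphere_measure n) (1 / q)"
    using assms by (intro SUP_least weak_functional_le) (simp_all add: Ck_compact_def)
qed (use assms weak_functional_tendsto_at_top weak_functional_tendsto_at_right_0 in simp_all)

end
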